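(* Let $V$ be a finite-dimensional irreducible $\mathfrak H$-module, regarded as an $\Re$-module by pulling back via $\zeta$. For $\theta\in\mathbb F$ let $V(\theta)=\{v\in V\mid t_0v=\theta v\}$. Then the following hold. (i) Suppose that $t_0$ is not diagonalizable on $V$. Then $0$ is the unique eigenvalue of $t_0$ in $V$. Moreover: (a) If $\dim V$ is even, then the $\Re$-submodules of $V$ are exactly $\{0\}$, $V(0)$ and $V$; they are pairwise distinct and form the chain $\{0\}\subset V(0)\subset V$. (b) If $\dim V$ is odd, then the $\Re$-submodules of $V$ are exactly $\{0\}$, $V(0)'$, $V(0)$ and $V$; they are pairwise distinct and form the chain $\{0\}\subset V(0)'\subset V(0)\subset V$, where $V(0)'$ is the irreducible $\Re$-submodule of $V(0)$ that has codimension $1$ in $V(0)$. (ii) Suppose that $t_0$ is diagonalizable on $V$. Then $t_0$ has at most two eigenvalues in $V$. Moreover: (a) If $t_0$ has exactly one eigenvalue in $V$, then the $\Re$-module $V$ is irreducible of dimension less than or equal to $2$. (b) If $t_0$ has exactly two eigenvalues in $V$, then there exists a nonzero scalar $\theta\in\mathbb F$ such that $\pm\theta$ are the eigenvalues of $t_0$ in $V$, and the $\Re$-submodules of $V$ are exactly the four pairwise distinct subspaces $\{0\}$, $V(-\theta)$, $V(\theta)$, $V$, where $V(-\theta)$ and $V(\theta)$ are incomparable under inclusion.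
   Context: Throughout, $\mathbb F$ is an algebraically closed field of characteristic zero; algebras are associative with unit $1$, and $[X,Y]=XY-YX$. The universal Racah algebra $\Re$ is the $\mathbb F$-algebra with generators $A,B,C,D$ and relations stating that $[A,B]=[B,C]=[C,A]=2D$ and that each of $[A,D]+AC-BA$, $[B,D]+BA-CB$, $[C,D]+CB-AC$ commutes with $A,B,C,D$. The universal additive DAHA $\mathfrak H$ of type $(C_1^\vee,C_1)$ is the $\mathbb F$-algebra with generators $t_0,t_1,t_0^\vee,t_1^\vee$ and relations stating that $t_0+t_1+t_0^\vee+t_1^\vee=-1$ and that each of $t_0^2,\ t_1^2,\ (t_0^{\vee})^2,\ (t_1^{\vee})^2$ commutes with $t_0,t_1,t_0^\vee,t_1^\vee$. There is a unique $\mathbb F$-algebra homomorphism $\zeta:\Re\to\mathfrak H$ with $$A\mapsto \frac{(t_1^\vee+t_0^\vee)(t_1^\vee+t_0^\vee+2)}{4},\quad B\mapsto \frac{(t_1+t_1^\vee)(t_1+t_1^\vee+2)}{4},\quad C\mapsto \frac{(t_0^\vee+t_1)(t_0^\vee+t_1+2)}{4}.$$ *)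

theory Defs
  imports "HOL-Library.Poly_Mapping" "HOL-Computational_Algebra.Polynomial"
begin

section \<open>Algebras over a field and their modules\<close>

locale assoc_algebra = vector_space scale
  for scale :: "'f::field \<Rightarrow> 'a::ring_1 \<Rightarrow> 'a" +
  assumes scale_mult_left: "scale c x * y = scale c (x * y)"
    and scale_mult_right: "x * scale c y = scale c (x * y)"

locale algebra_hom = dom: assoc_algebra scale1 + cod: assoc_algebra scale2
  for scale1 :: "'f::field \<Rightarrow> 'a::ring_1 \<Rightarrow> 'a" and scale2 :: "'f \<Rightarrow> 'b::ring_1 \<Rightarrow> 'b" +
  fixes f :: "'a \<Rightarrow> 'b"
  assumes hom_add: "f (x + y) = f x + f y"
    and hom_scale: "f (scale1 c x) = scale2 c (f x)"
    and hom_mult: "f (x * y) = f x * f y"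
    and hom_one: "f 1 = 1"

locale algebra_module = alg: assoc_algebra scaleA + vs: vector_space scaleV
  for scaleA :: "'f::field \<Rightarrow> 'a::ring_1 \<Rightarrow> 'a" and scaleV :: "'f \<Rightarrow> 'v::ab_group_add \<Rightarrow> 'v" +
  fixes act :: "'a \<Rightarrow> 'v \<Rightarrow> 'v"
  assumes act_add_right: "act x (v + w) = act x v + act x w"
    and act_add_left: "act (x + y) v = act x v + act y v"
    and act_scale: "act (scaleA c x) v = scaleV c (act x v)"
    and act_mult: "act (x * y) v = act x (act y v)"
    and act_one: "act 1 v = v"

definition alg_submodules ::
    "('f::field \<Rightarrow> 'v::ab_group_add \<Rightarrow> 'v) \<Rightarrow> ('a \<Rightarrow> 'v \<Rightarrow> 'v) \<Rightarrow> 'v set set" where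
  "alg_submodules scaleV act =
     {W. module.subspace scaleV W \<and> (\<forall>x. \<forall>w\<in>W. act x w \<in> W)}"

text \<open>A submodule \<open>U\<close> is irreducible as a module in its own right; \<open>U = UNIV\<close> gives
  irreducibility of the module itself.\<close>

definition irreducible_on ::
    "('f::field \<Rightarrow> 'v::ab_group_add \<Rightarrow> 'v) \<Rightarrow> ('a \<Rightarrow> 'v \<Rightarrow> 'v) \<Rightarrow> 'v set \<Rightarrow> bool" where
  "irreducible_on scaleV act U \<longleftrightarrow>
     U \<in> alg_submodules scaleV act \<and> U \<noteq> {0} \<and>
     (\<forall>W \<in> alg_submodules scaleV act. W \<subseteq> U \<longrightarrow> W = {0} \<or> W = U)"

definition op_eigenspace ::
    "('f::field \<Rightarrow> 'v::ab_group_add \<Rightarrow> 'v) \<Rightarrow> ('v \<Rightarrow> 'v) \<Rightarrow> 'f \<Rightarrow> 'v set" where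
  "op_eigenspace scaleV T \<theta> = {v. T v = scaleV \<theta> v}"

definition op_eigenvalues ::
    "('f::field \<Rightarrow> 'v::ab_group_add \<Rightarrow> 'v) \<Rightarrow> ('v \<Rightarrow> 'v) \<Rightarrow> 'f set" where
  "op_eigenvalues scaleV T = {\<theta>. \<exists>v. v \<noteq> 0 \<and> T v = scaleV \<theta> v}"

definition op_diagonalizable ::
    "('f::field \<Rightarrow> 'v::ab_group_add \<Rightarrow> 'v) \<Rightarrow> ('v \<Rightarrow> 'v) \<Rightarrow> bool" where
  "op_diagonalizable scaleV T \<longleftrightarrow>
     (\<exists>E. \<not> module.dependent scaleV E \<and> module.span scaleV E = UNIV \<and>
          (\<forall>e\<in>E. \<exists>\<theta>. T e = scaleV \<theta> e))"


section \<open>Free algebras and presentations\<close>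

text \<open>Words form the free monoid, written additively because \<open>poly_mapping\<close> uses the additive
  structure of its index type for its convolution product.\<close>

datatype 'g word = Word (letters: "'g list")

instantiation word :: (type) monoid_add
begin
definition "0 = Word []"
definition "u + v = Word (letters u @ letters v)"
instance by standard (auto simp: zero_word_def plus_word_def)
end

type_synonym ('f, 'g) free_algebra = "'g word \<Rightarrow>\<^sub>0 'f"

definition free_gen :: "'g \<Rightarrow> ('f::field, 'g) free_algebra" where
  "free_gen g = Poly_Mapping.single (Word [g]) 1"

definition free_scale :: "'f::field \<Rightarrow> ('f, 'g) free_algebra \<Rightarrow> ('f, 'g) free_algebra" where
  "free_scale c p = Poly_Mapping.single 0 c * p"

inductive_set two_sided_ideal :: "'a::ring_1 set \<Rightarrow> 'a set" for S where
  ideal_zero: "0 \<in> two_sided_ideal S"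
| ideal_step: "x \<in> two_sided_ideal S \<Longrightarrow> s \<in> S \<Longrightarrow> x + a * s * b \<in> two_sided_ideal S"

lemma ideal_gen: "s \<in> S \<Longrightarrow> s \<in> two_sided_ideal S"
  using ideal_step[OF ideal_zero, of s S 1 1] by simp

lemma ideal_add:
  assumes "x \<in> two_sided_ideal S" "y \<in> two_sided_ideal S"
  shows "x + y \<in> two_sided_ideal S"
  using assms(2)
  by induction (use assms(1) ideal_step in \<open>force simp: add.assoc[symmetric]\<close>)+

lemma ideal_mult:
  assumes "x \<in> two_sided_ideal S"
  shows "a * x * b \<in> two_sided_ideal S"
  using assms
proof induction
  case (ideal_step x s a' b')
  have "a * (x + a' * s * b') * b = a * x * b + (a * a') * s * (b' * b)"
    by (simp add: algebra_simps)
  then show ?case using ideal_step two_sided_ideal.ideal_step by metis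
qed (simp add: ideal_zero)

lemma ideal_mult_left: "x \<in> two_sided_ideal S \<Longrightarrow> a * x \<in> two_sided_ideal S"
  using ideal_mult[of x S a 1] by simp

lemma ideal_mult_right: "x \<in> two_sided_ideal S \<Longrightarrow> x * b \<in> two_sided_ideal S"
  using ideal_mult[of x S 1 b] by simp

lemma ideal_uminus: "x \<in> two_sided_ideal S \<Longrightarrow> - x \<in> two_sided_ideal S"
  using ideal_mult[of x S "-1" 1] by simp

lemma ideal_cong_equivp: "equivp (\<lambda>x y. x - y \<in> two_sided_ideal S)"
proof (rule equivpI)
  show "reflp (\<lambda>x y. x - y \<in> two_sided_ideal S)"
    by (auto intro!: reflpI ideal_zero)
  show "symp (\<lambda>x y. x - y \<in> two_sided_ideal S)"
    by (rule sympI) (metis ideal_uminus minus_diff_eq)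
  show "transp (\<lambda>x y. x - y \<in> two_sided_ideal S)"
  proof (rule transpI)
    fix x y z assume "x - y \<in> two_sided_ideal S" "y - z \<in> two_sided_ideal S"
    from ideal_add[OF this] show "x - z \<in> two_sided_ideal S" by simp
  qed
qed

lemma ideal_cong_add:
  "x - x' \<in> two_sided_ideal S \<Longrightarrow> y - y' \<in> two_sided_ideal S \<Longrightarrow>
   (x + y) - (x' + y') \<in> two_sided_ideal S"
  using ideal_add[of "x - x'" S "y - y'"] by (simp add: algebra_simps)

lemma ideal_cong_uminus:
  "x - x' \<in> two_sided_ideal S \<Longrightarrow> (- x) - (- x') \<in> two_sided_ideal S"
  using ideal_uminus[of "x - x'" S] by simp

lemma ideal_cong_diff:
  "x - x' \<in> two_sided_ideal S \<Longrightarrow> y - y' \<in> two_sided_ideal S \<Longrightarrow>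
   (x - y) - (x' - y') \<in> two_sided_ideal S"
  using ideal_cong_add[of x x' S "- y" "- y'"] ideal_cong_uminus[of y y' S] by simp

lemma ideal_cong_mult:
  assumes "x - x' \<in> two_sided_ideal S" "y - y' \<in> two_sided_ideal S"
  shows "x * y - x' * y' \<in> two_sided_ideal S"
proof -
  have "x * y - x' * y' = (x - x') * y + x' * (y - y')"
    by (simp add: algebra_simps)
  then show ?thesis
    using assms by (metis ideal_add ideal_mult_left ideal_mult_right)
qed

lemma poly_mapping_induct_single:
  fixes p :: "'k \<Rightarrow>\<^sub>0 'f::field"
  assumes "P 0" "\<And>p k c. P p \<Longrightarrow> P (p + Poly_Mapping.single k c)"
  shows "P p"
proof (induction p rule: update_induct)
  case (update p k c)
  have "Poly_Mapping.update k c p = p + Poly_Mapping.single k c"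
    using update(1)
    by (intro poly_mapping_eqI)
      (auto simp: lookup_update lookup_add lookup_single when_def in_keys_iff)
  then show ?case using update assms(2) by simp
qed (rule assms(1))

lemma free_scalar_central:
  "p * Poly_Mapping.single 0 c = Poly_Mapping.single 0 (c::'f::field) * (p :: 'g word \<Rightarrow>\<^sub>0 'f)"
  by (induction p rule: poly_mapping_induct_single)
    (simp_all add: distrib_left distrib_right mult_single mult.commute)

lemma assoc_algebra_free: "assoc_algebra (free_scale :: 'f::field \<Rightarrow> ('f, 'g) free_algebra \<Rightarrow> _)"
proof
  fix c d :: 'f and x y :: "('f, 'g) free_algebra"
  show "free_scale c (x + y) = free_scale c x + free_scale c y"
    "free_scale (c + d) x = free_scale c x + free_scale d x"
    "free_scale c (free_scale d x) = free_scale (c * d) x"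
    "free_scale 1 x = x"
    "free_scale c x * y = free_scale c (x * y)"
    by (simp_all add: free_scale_def algebra_simps single_add mult_single
        flip: mult.assoc)
  show "x * free_scale c y = free_scale c (x * y)"
    by (simp add: free_scale_def free_scalar_central flip: mult.assoc)
qed

definition free_lift ::
    "('f::field \<Rightarrow> 'a::ring_1 \<Rightarrow> 'a) \<Rightarrow> ('g \<Rightarrow> 'a) \<Rightarrow> ('f, 'g) free_algebra \<Rightarrow> 'a" where
  "free_lift scale f p =
     (\<Sum>w \<in> Poly_Mapping.keys p. scale (Poly_Mapping.lookup p w) (prod_list (map f (letters w))))"

context assoc_algebra
begin

lemma free_lift_superset:
  assumes "finite K" "Poly_Mapping.keys p \<subseteq> K"
  shows "free_lift scale f p =
     (\<Sum>w \<in> K. scale (Poly_Mapping.lookup p w) (prod_list (map f (letters w))))"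
  unfolding free_lift_def using assms
  by (intro sum.mono_neutral_left) (auto simp: in_keys_iff)

lemma free_lift_add: "free_lift scale f (p + q) = free_lift scale f p + free_lift scale f q"
proof -
  let ?K = "Poly_Mapping.keys p \<union> Poly_Mapping.keys q"
  have "Poly_Mapping.keys (p + q) \<subseteq> ?K" by (rule keys_add)
  then show ?thesis
    by (simp add: free_lift_superset[of ?K] lookup_add scale_left_distrib sum.distrib)
qed

lemma free_lift_single:
  "free_lift scale f (Poly_Mapping.single w c) = scale c (prod_list (map f (letters w)))"
  by (simp add: free_lift_superset[of "{w}"])

lemma free_lift_zero: "free_lift scale f 0 = 0"
  by (simp add: free_lift_def)

lemma free_lift_mult_single:
  "free_lift scale f (p * Poly_Mapping.single w c) =
   free_lift scale f p * free_lift scale f (Poly_Mapping.single w c)"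
  by (induction p rule: poly_mapping_induct_single)
    (simp_all add: free_lift_zero distrib_right free_lift_add mult_single free_lift_single
      plus_word_def scale_mult_left scale_mult_right scale_right_distrib mult.commute)

lemma free_lift_mult: "free_lift scale f (p * q) = free_lift scale f p * free_lift scale f q"
  by (induction q rule: poly_mapping_induct_single)
    (simp_all add: free_lift_zero distrib_left free_lift_add free_lift_mult_single)

lemma free_lift_one: "free_lift scale f 1 = 1"
  by (simp add: free_lift_single zero_word_def flip: single_one)

lemma free_lift_gen: "free_lift scale f (free_gen g) = f g"
  by (simp add: free_gen_def free_lift_single)

lemma free_lift_hom: "algebra_hom free_scale scale (free_lift scale f)"
proof -
  interpret free: assoc_algebra "free_scale :: 'f \<Rightarrow> ('f, 'c) free_algebra \<Rightarrow> _"
    by (rule assoc_algebra_free)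
  show ?thesis
    by unfold_locales
      (simp_all add: free_lift_add free_lift_mult free_lift_one free_scale_def free_lift_single
        zero_word_def scale_mult_left)
qed

end

lemma (in algebra_hom) hom_zero: "f 0 = 0"
  using hom_add[of 0 0] by simp

lemma (in algebra_hom) hom_uminus: "f (- x) = - f x"
  using hom_add[of x "- x"] by (simp add: hom_zero eq_neg_iff_add_eq_0 add.commute)

lemma (in algebra_hom) hom_diff: "f (x - y) = f x - f y"
  using hom_add[of x "- y"] by (simp add: hom_uminus)

lemma (in algebra_hom) hom_numeral: "f (numeral n) = numeral n"
  by (induction n) (simp_all only: numeral.simps hom_one hom_add)

lemma (in algebra_hom) hom_ideal:
  assumes "\<And>s. s \<in> S \<Longrightarrow> f s = 0" "x \<in> two_sided_ideal S"
  shows "f x = 0"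
  using assms(2) by induction (simp_all add: hom_zero hom_add hom_mult assms(1))

lemma free_hom_unique:
  fixes F G :: "('f::field, 'g) free_algebra \<Rightarrow> 'a::ring_1"
  assumes "algebra_hom free_scale scale F" "algebra_hom free_scale scale G"
    and gens: "\<And>g. F (free_gen g) = G (free_gen g)"
  shows "F = G"
proof
  fix p
  interpret F: algebra_hom free_scale scale F by fact
  interpret G: algebra_hom free_scale scale G by fact
  have word: "F (Poly_Mapping.single (Word gs) 1) = G (Poly_Mapping.single (Word gs) 1)" for gs
  proof (induction gs)
    case Nil
    have "Poly_Mapping.single (Word []) 1 = (1 :: ('f, 'g) free_algebra)"
      by (simp flip: zero_word_def)
    then show ?case by (simp add: F.hom_one G.hom_one)
  next
    case (Cons g gs)
    have "Poly_Mapping.single (Word (g # gs)) 1 =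
        free_gen g * (Poly_Mapping.single (Word gs) 1 :: ('f, 'g) free_algebra)"
      by (simp add: free_gen_def mult_single plus_word_def)
    then show ?case by (simp add: F.hom_mult G.hom_mult gens Cons)
  qed
  have single: "F (Poly_Mapping.single w c) = G (Poly_Mapping.single w c)" for w c
  proof -
    have "Poly_Mapping.single w c = free_scale c (Poly_Mapping.single w 1)"
      by (simp add: free_scale_def mult_single)
    then show ?thesis using word[of "letters w"] by (simp only: F.hom_scale G.hom_scale word.collapse)
  qed
  show "F p = G p"
    by (induction p rule: poly_mapping_induct_single)
      (simp_all add: F.hom_zero G.hom_zero F.hom_add G.hom_add single)
qed

lemma assoc_algebra_field: "assoc_algebra ((*) :: 'f::field \<Rightarrow> 'f \<Rightarrow> 'f)"
  by unfold_locales (simp_all add: algebra_simps)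


section \<open>The universal Racah algebra\<close>

datatype racah_gen = RA | RB | RC | RD

definition racah_relations :: "('f::field_char_0, racah_gen) free_algebra set" where
  "racah_relations =
     (let A = free_gen RA; B = free_gen RB; C = free_gen RC; D = free_gen RD in
       {A * B - B * A - 2 * D, B * C - C * B - 2 * D, C * A - A * C - 2 * D} \<union>
       {z * g - g * z | z g.
          z \<in> {(A * D - D * A) + A * C - B * A,
               (B * D - D * B) + B * A - C * B,
               (C * D - D * C) + C * B - A * C} \<and>
          g \<in> {A, B, C, D}})"

lemma racah_one_notin: "1 \<notin> two_sided_ideal (racah_relations :: ('f::field_char_0, racah_gen) free_algebra set)"
proof
  interpret fld: assoc_algebra "(*) :: 'f \<Rightarrow> 'f \<Rightarrow> 'f" by (rule assoc_algebra_field)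
  let ?e = "\<lambda>g::racah_gen. 0 :: 'f"
  interpret h: algebra_hom free_scale "(*) :: 'f \<Rightarrow> 'f \<Rightarrow> 'f" "free_lift (*) ?e"
    by (rule fld.free_lift_hom)
  assume "1 \<in> two_sided_ideal (racah_relations :: ('f, racah_gen) free_algebra set)"
  then have "free_lift (*) ?e 1 = 0"
    by (rule h.hom_ideal[rotated])
      (auto simp: racah_relations_def Let_def h.hom_mult h.hom_diff h.hom_add h.hom_one h.hom_numeral
        fld.free_lift_gen)
  then show False by (simp add: h.hom_one)
qed

quotient_type (overloaded) 'f racah = "('f::field_char_0, racah_gen) free_algebra" /
  "\<lambda>x y. x - y \<in> two_sided_ideal racah_relations"
  by (rule ideal_cong_equivp)

instantiation racah :: (field_char_0) ring_1
begin

lift_definition zero_racah :: "'a racah" is 0 .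
lift_definition one_racah :: "'a racah" is 1 .
lift_definition plus_racah :: "'a racah \<Rightarrow> 'a racah \<Rightarrow> 'a racah" is "(+)"
  by (rule ideal_cong_add)
lift_definition uminus_racah :: "'a racah \<Rightarrow> 'a racah" is uminus
  by (rule ideal_cong_uminus)
lift_definition minus_racah :: "'a racah \<Rightarrow> 'a racah \<Rightarrow> 'a racah" is "(-)"
  by (rule ideal_cong_diff)
lift_definition times_racah :: "'a racah \<Rightarrow> 'a racah \<Rightarrow> 'a racah" is "(*)"
  by (rule ideal_cong_mult)

instance
proof
  show "(0::'a racah) \<noteq> 1"
    by transfer (use racah_one_notin ideal_uminus in fastforce)
qed (transfer; simp add: algebra_simps ideal_zero)+

end

lift_definition racah_scale :: "'f::field_char_0 \<Rightarrow> 'f racah \<Rightarrow> 'f racah" is free_scale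
  unfolding free_scale_def by (rule ideal_cong_mult) (simp_all add: ideal_zero)

lemma assoc_algebra_racah: "assoc_algebra (racah_scale :: 'f::field_char_0 \<Rightarrow> _)"
proof -
  interpret free: assoc_algebra "free_scale :: 'f \<Rightarrow> ('f, racah_gen) free_algebra \<Rightarrow> _"
    by (rule assoc_algebra_free)
  show ?thesis
  proof
    fix c d :: 'f and x y :: "'f racah"
    show "racah_scale c (x + y) = racah_scale c x + racah_scale c y"
      by transfer (simp add: free.scale_right_distrib ideal_zero)
    show "racah_scale (c + d) x = racah_scale c x + racah_scale d x"
      by transfer (simp add: free.scale_left_distrib ideal_zero)
    show "racah_scale c (racah_scale d x) = racah_scale (c * d) x"
      by transfer (simp add: ideal_zero)
    show "racah_scale 1 x = x"
      by transfer (simp add: ideal_zero)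
    show "racah_scale c x * y = racah_scale c (x * y)"
      by transfer (simp add: free.scale_mult_left ideal_zero)
    show "x * racah_scale c y = racah_scale c (x * y)"
      by transfer (simp add: free.scale_mult_right ideal_zero)
  qed
qed

lemma abs_racah_hom: "algebra_hom free_scale racah_scale (abs_racah :: _ \<Rightarrow> 'f::field_char_0 racah)"
proof -
  interpret free: assoc_algebra "free_scale :: 'f \<Rightarrow> ('f, racah_gen) free_algebra \<Rightarrow> _"
    by (rule assoc_algebra_free)
  interpret quot: assoc_algebra "racah_scale :: 'f \<Rightarrow> _"
    by (rule assoc_algebra_racah)
  show ?thesis
    by unfold_locales
      (simp_all add: plus_racah.abs_eq times_racah.abs_eq one_racah_def racah_scale.abs_eq)
qed

lemma abs_racah_relation: "s \<in> racah_relations \<Longrightarrow> abs_racah s = (0 :: 'f::field_char_0 racah)"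
  unfolding zero_racah_def racah.abs_eq_iff by (simp add: ideal_gen)


definition racah_A :: "'f::field_char_0 racah" where "racah_A = abs_racah (free_gen RA)"
definition racah_B :: "'f::field_char_0 racah" where "racah_B = abs_racah (free_gen RB)"
definition racah_C :: "'f::field_char_0 racah" where "racah_C = abs_racah (free_gen RC)"
definition racah_D :: "'f::field_char_0 racah" where "racah_D = abs_racah (free_gen RD)"


section \<open>The universal additive DAHA of type \<open>(C\<^sub>1\<^sup>\<or>, C\<^sub>1)\<close>\<close>

text \<open>\<open>T0v\<close> and \<open>T1v\<close> stand for \<open>t\<^sub>0\<^sup>\<or>\<close> and \<open>t\<^sub>1\<^sup>\<or>\<close>.\<close>

datatype daha_gen = T0 | T1 | T0v | T1v

definition daha_relations :: "('f::field_char_0, daha_gen) free_algebra set" where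
  "daha_relations =
     {free_gen T0 + free_gen T1 + free_gen T0v + free_gen T1v + 1} \<union>
     {free_gen s * free_gen s * free_gen t - free_gen t * (free_gen s * free_gen s) | s t. True}"

lemma daha_one_notin: "1 \<notin> two_sided_ideal (daha_relations :: ('f::field_char_0, daha_gen) free_algebra set)"
proof
  interpret fld: assoc_algebra "(*) :: 'f \<Rightarrow> 'f \<Rightarrow> 'f" by (rule assoc_algebra_field)
  let ?e = "\<lambda>g::daha_gen. if g = T0 then - 1 else (0 :: 'f)"
  interpret h: algebra_hom free_scale "(*) :: 'f \<Rightarrow> 'f \<Rightarrow> 'f" "free_lift (*) ?e"
    by (rule fld.free_lift_hom)
  assume "1 \<in> two_sided_ideal (daha_relations :: ('f, daha_gen) free_algebra set)"
  then have "free_lift (*) ?e 1 = 0"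
    by (rule h.hom_ideal[rotated])
      (auto simp: daha_relations_def Let_def h.hom_mult h.hom_diff h.hom_add h.hom_one h.hom_numeral
        fld.free_lift_gen)
  then show False by (simp add: h.hom_one)
qed

quotient_type (overloaded) 'f daha = "('f::field_char_0, daha_gen) free_algebra" /
  "\<lambda>x y. x - y \<in> two_sided_ideal daha_relations"
  by (rule ideal_cong_equivp)

instantiation daha :: (field_char_0) ring_1
begin

lift_definition zero_daha :: "'a daha" is 0 .
lift_definition one_daha :: "'a daha" is 1 .
lift_definition plus_daha :: "'a daha \<Rightarrow> 'a daha \<Rightarrow> 'a daha" is "(+)"
  by (rule ideal_cong_add)
lift_definition uminus_daha :: "'a daha \<Rightarrow> 'a daha" is uminus
  by (rule ideal_cong_uminus)
lift_definition minus_daha :: "'a daha \<Rightarrow> 'a daha \<Rightarrow> 'a daha" is "(-)"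
  by (rule ideal_cong_diff)
lift_definition times_daha :: "'a daha \<Rightarrow> 'a daha \<Rightarrow> 'a daha" is "(*)"
  by (rule ideal_cong_mult)

instance
proof
  show "(0::'a daha) \<noteq> 1"
    by transfer (use daha_one_notin ideal_uminus in fastforce)
qed (transfer; simp add: algebra_simps ideal_zero)+

end

lift_definition daha_scale :: "'f::field_char_0 \<Rightarrow> 'f daha \<Rightarrow> 'f daha" is free_scale
  unfolding free_scale_def by (rule ideal_cong_mult) (simp_all add: ideal_zero)

lemma assoc_algebra_daha: "assoc_algebra (daha_scale :: 'f::field_char_0 \<Rightarrow> _)"
proof -
  interpret free: assoc_algebra "free_scale :: 'f \<Rightarrow> ('f, daha_gen) free_algebra \<Rightarrow> _"
    by (rule assoc_algebra_free)
  show ?thesis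
  proof
    fix c d :: 'f and x y :: "'f daha"
    show "daha_scale c (x + y) = daha_scale c x + daha_scale c y"
      by transfer (simp add: free.scale_right_distrib ideal_zero)
    show "daha_scale (c + d) x = daha_scale c x + daha_scale d x"
      by transfer (simp add: free.scale_left_distrib ideal_zero)
    show "daha_scale c (daha_scale d x) = daha_scale (c * d) x"
      by transfer (simp add: ideal_zero)
    show "daha_scale 1 x = x"
      by transfer (simp add: ideal_zero)
    show "daha_scale c x * y = daha_scale c (x * y)"
      by transfer (simp add: free.scale_mult_left ideal_zero)
    show "x * daha_scale c y = daha_scale c (x * y)"
      by transfer (simp add: free.scale_mult_right ideal_zero)
  qed
qed

lemma abs_daha_hom: "algebra_hom free_scale daha_scale (abs_daha :: _ \<Rightarrow> 'f::field_char_0 daha)"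
proof -
  interpret free: assoc_algebra "free_scale :: 'f \<Rightarrow> ('f, daha_gen) free_algebra \<Rightarrow> _"
    by (rule assoc_algebra_free)
  interpret quot: assoc_algebra "daha_scale :: 'f \<Rightarrow> _"
    by (rule assoc_algebra_daha)
  show ?thesis
    by unfold_locales
      (simp_all add: plus_daha.abs_eq times_daha.abs_eq one_daha_def daha_scale.abs_eq)
qed

lemma abs_daha_relation: "s \<in> daha_relations \<Longrightarrow> abs_daha s = (0 :: 'f::field_char_0 daha)"
  unfolding zero_daha_def daha.abs_eq_iff by (simp add: ideal_gen)


definition daha_t0 :: "'f::field_char_0 daha" where "daha_t0 = abs_daha (free_gen T0)"
definition daha_t1 :: "'f::field_char_0 daha" where "daha_t1 = abs_daha (free_gen T1)"
definition daha_t0v :: "'f::field_char_0 daha" where "daha_t0v = abs_daha (free_gen T0v)"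
definition daha_t1v :: "'f::field_char_0 daha" where "daha_t1v = abs_daha (free_gen T1v)"


section \<open>The homomorphism from the Racah algebra to the additive DAHA\<close>

lemma commute_mult: "z*x=x*z \<Longrightarrow> z*y=y*z \<Longrightarrow> z*(x*y)=(x*y)*(z::'r::ring_1)" by (metis mult.assoc)
lemma commute_add: "z*x=x*z \<Longrightarrow> z*y=y*z \<Longrightarrow> z*(x+y)=(x+y)*(z::'r::ring_1)" by (simp add: algebra_simps)

lemma commute_square_sum: "z*a=a*z \<Longrightarrow> z*b=b*z \<Longrightarrow> (a+b)*(a+b)*z=z*((a+b)*(a+b::'r::ring_1))" by (intro commute_mult[symmetric] commute_add)
lemma commute_anticommutator: "z*a=a*z \<Longrightarrow> z*b=b*z \<Longrightarrow> (a*b+b*a)*z=z*(a*b+b*(a::'r::ring_1))" by (rule commute_add[symmetric]; rule commute_mult)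

lemma numeral_mults: "2*x=x+x" "x*2=x+x" "3*x=x+x+x" "x*3=x+x+x" "4*x=x+x+x+x" "x*4=x+x+x+x" 
  "8*x=x+x+x+x+x+x+(x::'r::ring_1)+x" "x*8=x+x+x+x+x+x+x+x" 
proof -
  have n: "(3::'r) = 1+1+1" "(4::'r) = 1+1+1+1" "(8::'r) = 1+1+1+1+1+1+1+1" by simp_all
  show "2*x=x+x" "x*2=x+x" by (rule mult_2 mult_2_right)+
  show "3*x=x+x+x" "x*3=x+x+x" "4*x=x+x+x+x" "x*4=x+x+x+x" "8*x=x+x+x+x+x+x+x+x" "x*8=x+x+x+x+x+x+x+x" 
    unfolding n by (simp_all only: distrib_left distrib_right mult_1 mult_1_right)
qed

lemma racah_identities:
  fixes a b c d :: "'r::ring_1"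
  assumes s: "d = - (a + b + c + 1)"
    and al: "a*a*b = b*(a*a)" "a*a*c = c*(a*a)"
    and be: "b*b*a = a*(b*b)" "b*b*c = c*(b*b)"
    and ga: "c*c*a = a*(c*c)" "c*c*b = b*(c*c)"
    and de: "d*d*a = a*(d*d)" "d*d*b = b*(d*d)" "d*d*c = c*(d*d)"
  defines "P \<equiv> (a+b)*(a+b)" and "Q \<equiv> (a+c)*(a+c)" and "S \<equiv> (a+d)*(a+d)"
  shows "P*Q - Q*P = Q*S - S*Q" "P*Q - Q*P = S*P - P*S"
   "P*a = a*P" 
   "P*(P*Q-Q*P) - (P*Q-Q*P)*P + 8*(P*S - Q*P - S + Q) = 8*((c*c-d*d)*(a*a-b*b-2*a+1))"
proof -
  define y where "y = a + b + 1"
  define k where "k = d*d - c*c"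
  define q where "q = a*c + c*a"
  define u where "u = P*c - c*P"
  have k: "k*a = a*k" "k*b = b*k" "k*c = c*k" using de ga by (auto simp: k_def algebra_simps)
  have ky: "k*y = y*k" using k by (simp add: y_def algebra_simps)
  have cy: "c*y + y*c = k - y*y" unfolding k_def s y_def by (simp add: algebra_simps)
  have cY: "c*(y*y) = (y*y)*c"
  proof -
    have "c*(k-y*y) - (k-y*y)*c = c*(c*y+y*c) - (c*y+y*c)*c" by (simp only: cy)
    also have "\<dots> = c*c*y - y*(c*c)" by (simp add: algebra_simps)
    also have "\<dots> = 0" using ga by (simp add: y_def algebra_simps)
    finally show ?thesis using k by (simp add: algebra_simps)
  qed
  have PY: "P = y*y - 2*y + 1" unfolding P_def y_def by (simp add: algebra_simps numeral_mults)
  have Pa: "P*a = a*P" using al be unfolding P_def by (simp add: algebra_simps)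
  have Py: "P*y = y*P" unfolding PY by (simp add: algebra_simps numeral_mults)
  have Qq: "Q = a*a+c*c+q" unfolding Q_def q_def by (simp add: algebra_simps)
  have uc: "u = 2*(c*y-y*c)" unfolding u_def PY using cY by (simp add: algebra_simps numeral_mults)
  have Pal: "P*(a*a+c*c) = (a*a+c*c)*P" 
  proof -
    have "P*(a*a) = (a*a)*P" "P*(c*c) = (c*c)*P" unfolding P_def using al ga by (intro commute_square_sum; simp add: mult.assoc)+
    then show ?thesis by (simp add: algebra_simps)
  qed
  have PQ: "P*Q - Q*P = a*u+u*a"
  proof -
    have "P*Q-Q*P = P*q-q*P" unfolding Qq using Pal by (simp add: algebra_simps)
    also have "\<dots> = (P*a)*c + P*c*a - a*c*P - c*(a*P)" unfolding q_def by (simp add: algebra_simps)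
    also have "\<dots> = a*u+u*a" unfolding u_def using Pa by (simp add: algebra_simps)
    finally show ?thesis .
  qed
  have yu: "y*u = -(u*y)" unfolding uc using cY by (simp add: algebra_simps numeral_mults)
  have Yu: "y*y*u = u*(y*y)" using yu by (metis mult.assoc minus_mult_left minus_mult_right minus_minus)
  have Pu: "P*u - u*P = -4*(y*u)" 
  proof -
    have "P*u-u*P = -2*(y*u) + 2*(u*y)" unfolding PY using Yu by (simp add: algebra_simps numeral_mults)
    also have "u*y = -(y*u)" using yu by simp
    finally show ?thesis by (simp add: numeral_mults)
  qed
  have PPQ: "P*(P*Q-Q*P) - (P*Q-Q*P)*P = -8*(a*y*c*y + y*c*y*a - a*c*(y*y) - (y*y)*c*a)"
  proof -
    have "P*(a*u+u*a) - (a*u+u*a)*P = (P*a)*u + P*u*a - a*u*P - u*(a*P)" by (simp add: algebra_simps numeral_mults)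
    also have "\<dots> = a*(P*u-u*P) + (P*u-u*P)*a" unfolding Pa[symmetric] by (simp add: algebra_simps Pa)
    also have "\<dots> = -4*(a*(y*u)) + -4*((y*u)*a)" unfolding Pu by (simp add: algebra_simps numeral_mults)
    also have "\<dots> = -4*(a*y*u) + 4*(u*y*a)" unfolding yu by (simp add: yu mult.assoc)
    also have "\<dots> = -8*(a*y*c*y + y*c*y*a - a*(y*y*c) - (c*(y*y))*a)" unfolding uc by (simp add: algebra_simps numeral_mults)
    also have "a*(y*y*c) = a*c*(y*y)" by (metis cY mult.assoc)
    also have "(c*(y*y))*a = y*y*c*a" by (simp only: cY)
    finally show ?thesis unfolding PQ .
  qed
  have Ss: "S = d*d - a*a - 2*a - (a*b+b*a) - q" unfolding S_def s q_def by (simp add: algebra_simps numeral_mults)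
  have dS: "S = d*d - 2*a + b*b - P - q" unfolding Ss P_def by (simp add: algebra_simps)
  show "P*a = a*P" by (rule Pa)
  have Pd: "P*(d*d) = (d*d)*P" "P*(b*b) = (b*b)*P" unfolding P_def using al be de by (intro commute_square_sum; simp add: mult.assoc)+
  have Pq: "P*q-q*P = P*Q-Q*P" unfolding Qq using Pal by (simp add: algebra_simps)
  show "P*Q - Q*P = S*P - P*S" unfolding Pq[symmetric] dS using Pd Pa by (simp add: algebra_simps numeral_mults)
  have qa: "a*q = q*a" unfolding q_def using al by (simp add: algebra_simps)
  have qd: "q*(d*d) = (d*d)*q" "q*(b*b) = (b*b)*q" "q*(a*a) = (a*a)*q" "q*(c*c) = (c*c)*q" 
    unfolding q_def using al be de ga by (intro commute_anticommutator; simp add: mult.assoc)+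
  have Qa: "a*Q = Q*a" unfolding Qq using qa ga by (simp add: algebra_simps)
  have Qd: "Q*(d*d) = (d*d)*Q" "Q*(b*b) = (b*b)*Q" "Q*q = q*Q" 
  proof -
    have "(d*d)*(a*a) = (a*a)*(d*d)" "(d*d)*(c*c) = (c*c)*(d*d)" "(b*b)*(a*a) = (a*a)*(b*b)" "(b*b)*(c*c) = (c*c)*(b*b)"
      using be de by (intro commute_mult; simp add: mult.assoc)+
    then show "Q*(d*d) = (d*d)*Q" "Q*(b*b) = (b*b)*Q" "Q*q = q*Q" unfolding Qq using qd
    by (simp_all only: distrib_left distrib_right)
  qed
  show "P*Q - Q*P = Q*S - S*Q" unfolding dS using Qa Qd by (simp add: algebra_simps numeral_mults)
  have ay: "a*y+y*a = 2*(a*a) + (a*b+b*a) + 2*a" unfolding y_def by (simp add: algebra_simps numeral_mults)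
  let ?R = "a*y*c*y + y*c*y*a - a*c*(y*y) - (y*y)*c*a"
  have "P*S - Q*P - S + Q - ?R = (c*c-d*d)*(a*a-b*b-2*a+1)"
  proof -
    have ycy: "y*c = k - y*y - c*y" "c*y = k - y*y - y*c" using cy by (simp_all add: algebra_simps)
    have "?R = a*y*(c*y) + (y*c)*y*a - a*c*(y*y) - (y*y)*c*a" by (simp add: mult.assoc)
    also have "\<dots> = a*y*(k - y*y - y*c) + (k - y*y - c*y)*y*a - a*c*(y*y) - (y*y)*c*a" by (simp only: ycy(1)[symmetric] ycy(2)[symmetric])
    also have "\<dots> = k*(a*y+y*a) - a*y*y*y - y*y*y*a - (a*(y*y*c) + (c*(y*y))*a + a*c*(y*y) + (y*y)*c*a)"
      using k ky by (simp add: algebra_simps) (metis mult.assoc)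
    also have "a*(y*y*c) + (c*(y*y))*a + a*c*(y*y) + (y*y)*c*a = 2*(a*c*(y*y) + (y*y)*c*a)"
      unfolding cY[symmetric] by (simp add: cY mult.assoc numeral_mults)
    finally have R: "?R = k*(a*y+y*a) - a*y*y*y - y*y*y*a - 2*(a*c*(y*y) + (y*y)*c*a)" .
    have Y: "y*y = P + 2*y - 1" unfolding PY by simp
    have G: "a*c*(y*y) + (y*y)*c*a = a*c*P + P*c*a + 2*(a*(c*y) + (y*c)*a) - q"
      unfolding Y q_def by (simp add: algebra_simps numeral_mults)
    have "a*(c*y) + (y*c)*a + (a*(y*c) + (c*y)*a) = a*(c*y+y*c) + (c*y+y*c)*a" by (simp add: algebra_simps)
    then have H: "a*(c*y) + (y*c)*a + (a*(y*c) + (c*y)*a) = a*(k-y*y) + (k-y*y)*a" by (simp only: cy)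
    have F: "2*(a*c*P + P*c*a) - (P*q+q*P) = 2*(a*(y*c) + (c*y)*a) - 2*(a*(c*y) + (y*c)*a)"
    proof -
      have "2*(a*c*P + P*c*a) - (P*q+q*P) = a*c*P + P*c*a - (P*a)*c - c*(a*P)" unfolding q_def by (simp add: algebra_simps numeral_mults)
      also have "\<dots> = u*a - a*u" unfolding u_def Pa by (simp add: Pa[symmetric] algebra_simps) (simp add: Pa mult.assoc[symmetric])
      finally show ?thesis unfolding uc by (simp add: algebra_simps numeral_mults)
    qed
    have "P*S - Q*P - S + Q - ?R = P*(d*d - 2*a + b*b - P) - (a*a+c*c)*P - (P*q+q*P) - (d*d - 2*a + b*b - P) + (a*a + c*c) + 2*q
       - k*(a*y+y*a) + a*y*y*y + y*y*y*a + 2*(a*c*(y*y) + (y*y)*c*a)"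
      unfolding R dS Qq by (simp add: algebra_simps numeral_mults)
    also have "\<dots> = P*(d*d - 2*a + b*b - P) - (a*a+c*c)*P - (d*d - 2*a + b*b - P) + (a*a + c*c) 
       - k*(a*y+y*a) + a*y*y*y + y*y*y*a + (2*(a*c*P + P*c*a) - (P*q+q*P)) + 4*(a*(c*y) + (y*c)*a)"
      unfolding G by (simp add: algebra_simps numeral_mults)
    also have "\<dots> = P*(d*d - 2*a + b*b - P) - (a*a+c*c)*P - (d*d - 2*a + b*b - P) + (a*a + c*c) 
       - k*(a*y+y*a) + a*y*y*y + y*y*y*a + 2*(a*(c*y) + (y*c)*a + (a*(y*c) + (c*y)*a))"
      unfolding F by (simp add: algebra_simps numeral_mults)
    also have "\<dots> = P*(d*d - 2*a + b*b - P) - (a*a+c*c)*P - (d*d - 2*a + b*b - P) + (a*a + c*c) 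
       - k*(a*y+y*a) + a*y*y*y + y*y*y*a + 2*(a*(k-y*y) + (k-y*y)*a)"
      unfolding H ..
    also have "\<dots> = (c*c-d*d)*(a*a-b*b-2*a+1)"
    proof -
      have Pm: "P = a*a + b*b + (a*b+b*a)" unfolding P_def by (simp add: algebra_simps)
      have aY: "a*(y*y) = (P-1)*a + 2*(a*y)" "(y*y)*a = (P-1)*a + 2*(y*a)" unfolding Y using Pa by (simp_all add: algebra_simps numeral_mults)
      have T: "a*y + y*a = P + a*a - b*b + 2*a" unfolding ay Pm by (simp add: numeral_mults)
      have c3: "a*y*y*y + y*y*y*a = (P+3)*(a*y+y*a) + 4*((P-1)*a)"
      proof -
        have y3: "y*(y*y) = (P+3)*y + 2*P - 2"
        proof -
          have "y*(y*y) = y*(P + 2*y - 1)" by (simp only: Y)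
          also have "\<dots> = P*y + 2*(y*y) - y" using Py by (simp add: algebra_simps numeral_mults)
          also have "\<dots> = (P+3)*y + 2*P - 2" unfolding Y by (simp add: algebra_simps numeral_mults)
          finally show ?thesis .
        qed
        have "a*y*y*y + y*y*y*a = a*(y*(y*y)) + (y*(y*y))*a" by (simp add: mult.assoc)
        also have "\<dots> = (a*P)*y + 3*(a*y) + 2*(a*P) - 2*a + (P+3)*y*a + 2*P*a - 2*a" unfolding y3 by (simp add: algebra_simps numeral_mults)
        also have "\<dots> = (P+3)*(a*y+y*a) + 4*((P-1)*a)" unfolding Pa[symmetric] by (simp add: algebra_simps numeral_mults)
        finally show ?thesis .
      qed
      have s2: "a*(k-y*y) + (k-y*y)*a = 2*(k*a) - 2*((P-1)*a) - 2*(a*y+y*a)"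
      proof -
        have "a*(k-y*y) + (k-y*y)*a = 2*(k*a) - a*(y*y) - (y*y)*a" using k by (simp add: algebra_simps numeral_mults)
        then show ?thesis unfolding aY by (simp add: algebra_simps numeral_mults)
      qed
      have Pc: "(a*a+c*c)*P = P*(a*a+c*c)" using Pal by simp
      have Pcc: "P*(c*c) = (c*c)*P" 
        unfolding P_def using ga by (intro commute_square_sum; simp add: mult.assoc)+
      let ?X = "P + a*a - b*b + 2*a"
      have "P*(d*d - 2*a + b*b - P) - (a*a+c*c)*P - (d*d - 2*a + b*b - P) + (a*a + c*c) 
       - k*(a*y+y*a) + a*y*y*y + y*y*y*a + 2*(a*(k-y*y) + (k-y*y)*a)
       = P*(d*d - 2*a + b*b - P) - (a*a+c*c)*P - (d*d - 2*a + b*b - P) + (a*a + c*c) 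
       - k*(a*y+y*a) + (a*y*y*y + y*y*y*a) + 2*(a*(k-y*y) + (k-y*y)*a)"
        by (simp only: add.assoc)
      also have "\<dots> = P*(d*d - 2*a + b*b - P) - P*(a*a+c*c) - (d*d - 2*a + b*b - P) + (a*a + c*c) 
       - k*?X + ((P+3)*?X + 4*((P-1)*a)) + 2*(2*(k*a) - 2*((P-1)*a) - 2*?X)"
        by (simp only: c3 s2 Pc T)
      also have "\<dots> = P*(d*d-c*c) - k - k*?X + 4*(k*a)" unfolding k_def
        by (simp add: algebra_simps numeral_mults)
      also have "\<dots> = (c*c-d*d)*(a*a-b*b-2*a+1)" unfolding k_def
        using Pd Pcc by (simp add: algebra_simps numeral_mults)
      finally show ?thesis .
    qed
    finally show ?thesis .
  qed
  then have "8*(P*S - Q*P - S + Q - ?R) = 8*((c*c-d*d)*(a*a-b*b-2*a+1))" by (simp only:)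
  moreover have "-8*r + 8*x = 8*(x - r)" for x r :: 'r by (simp add: right_diff_distrib)
  ultimately show "P*(P*Q-Q*P) - (P*Q-Q*P)*P + 8*(P*S - Q*P - S + Q) = 8*((c*c-d*d)*(a*a-b*b-2*a+1))"
    unfolding PPQ by (simp only:)
qed

lemma (in assoc_algebra) scale_numeral: "scale (numeral n) x = numeral n * x"
  by (induction n) (simp_all only: numeral.simps scale_left_distrib distrib_right mult_1 scale_one)

text \<open>The quadratic expressions in \<open>t\<^sub>0, t\<^sub>1, t\<^sub>0\<^sup>\<or>, t\<^sub>1\<^sup>\<or>\<close> (here \<open>a, b, c, d\<close>) satisfy the relations
  of the Racah algebra.\<close>

lemma racah_from_daha:
  fixes scale :: "'f::field_char_0 \<Rightarrow> 'r::ring_1 \<Rightarrow> 'r"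
  assumes alg: "assoc_algebra scale"
    and sum: "a + b + c + d + 1 = 0"
    and central: "\<forall>x\<in>{a, b, c, d}. \<forall>y\<in>{a, b, c, d}. x * x * y = y * (x * x)"
  defines "A \<equiv> scale (1/4) ((d + c) * (d + c + 2))"
    and "B \<equiv> scale (1/4) ((b + d) * (b + d + 2))"
    and "C \<equiv> scale (1/4) ((c + b) * (c + b + 2))"
  defines "D \<equiv> scale (1/2) (A * B - B * A)"
  shows "A * B - B * A = 2 * D" "B * C - C * B = 2 * D" "C * A - A * C = 2 * D"
    and "z \<in> {(A * D - D * A) + A * C - B * A, (B * D - D * B) + B * A - C * B,
            (C * D - D * C) + C * B - A * C} \<Longrightarrow> g \<in> {A, B, C, D} \<Longrightarrow> z * g = g * z"
proof -
  interpret assoc_algebra scale by (rule alg)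
  let ?P = "(a + b) * (a + b)" and ?Q = "(a + c) * (a + c)" and ?S = "(a + d) * (a + d)"
  let ?X = "?P * ?Q - ?Q * ?P"
  have d: "d = - (a + b + c + 1)" and b: "b = - (a + c + d + 1)" and c: "c = - (a + d + b + 1)"
    using sum by (simp_all add: eq_neg_iff_add_eq_0 algebra_simps)
  have sq: "x * x * y = y * (x * x)" if "x \<in> {a, b, c, d}" "y \<in> {a, b, c, d}" for x y
    using central that by blast
  note sq' = sq[of a b] sq[of a c] sq[of a d] sq[of b a] sq[of b c] sq[of b d]
    sq[of c a] sq[of c b] sq[of c d] sq[of d a] sq[of d b] sq[of d c]
  have rel1: "?X = ?Q * ?S - ?S * ?Q" "?X = ?S * ?P - ?P * ?S" "?P * a = a * ?P"
      "?P * ?X - ?X * ?P + 8 * (?P * ?S - ?Q * ?P - ?S + ?Q) =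
       8 * ((c * c - d * d) * (a * a - b * b - 2 * a + 1))"
    by (rule racah_identities[OF d]; use sq' in simp)+
  have rel2: "?Q * a = a * ?Q"
      "?Q * (?Q * ?S - ?S * ?Q) - (?Q * ?S - ?S * ?Q) * ?Q + 8 * (?Q * ?P - ?S * ?Q - ?P + ?S) =
       8 * ((d * d - b * b) * (a * a - c * c - 2 * a + 1))"
    by (rule racah_identities[OF b]; use sq' in simp)+
  have rel3: "?S * a = a * ?S"
      "?S * (?S * ?P - ?P * ?S) - (?S * ?P - ?P * ?S) * ?S + 8 * (?S * ?Q - ?P * ?S - ?Q + ?P) =
       8 * ((b * b - c * c) * (a * a - d * d - 2 * a + 1))"
    by (rule racah_identities[OF c]; use sq' in simp)+
  have A: "A = scale (1/4) (?P - 1)"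
    unfolding A_def d by (simp add: algebra_simps numeral_mults)
  have B: "B = scale (1/4) (?Q - 1)"
    unfolding B_def b by (simp add: algebra_simps numeral_mults)
  have C: "C = scale (1/4) (?S - 1)"
    unfolding C_def c by (simp add: algebra_simps numeral_mults)
  have AB: "A * B - B * A = scale (1/16) ?X"
    unfolding A B by (simp add: scale_mult_left scale_mult_right algebra_simps)
  have BC: "B * C - C * B = scale (1/16) ?X"
    unfolding rel1(1) unfolding B C by (simp add: scale_mult_left scale_mult_right algebra_simps)
  have CA: "C * A - A * C = scale (1/16) ?X"
    unfolding rel1(2) unfolding C A by (simp add: scale_mult_left scale_mult_right algebra_simps)
  have D: "D = scale (1/32) ?X"
    unfolding D_def AB by simp
  have D2: "2 * D = scale (1/16) ?X"
    unfolding D by (simp flip: scale_numeral)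
  show "A * B - B * A = 2 * D" "B * C - C * B = 2 * D" "C * A - A * C = 2 * D"
    by (simp_all only: AB BC CA D2)
  have comb: "scale (1/4) (U - 1) * scale (1/32) Y - scale (1/32) Y * scale (1/4) (U - 1)
        + scale (1/4) (U - 1) * scale (1/4) (W - 1) - scale (1/4) (V - 1) * scale (1/4) (U - 1)
      = scale (1/16) E"
    if "U * Y - Y * U + 8 * (U * W - V * U - W + V) = 8 * E" for U V W Y E
  proof -
    have "scale (1/4) (U - 1) * scale (1/32) Y - scale (1/32) Y * scale (1/4) (U - 1)
        + scale (1/4) (U - 1) * scale (1/4) (W - 1) - scale (1/4) (V - 1) * scale (1/4) (U - 1)
      = scale (1/128) (U * Y - Y * U) + scale (1/16) (U * W - V * U - W + V)"
      by (simp add: scale_mult_left scale_mult_right algebra_simps)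
    also have "scale (1/16) (U * W - V * U - W + V) =
        scale (1/128) (8 * (U * W - V * U - W + V))"
      by (simp flip: scale_numeral)
    also have "scale (1/128) (U * Y - Y * U) + \<dots> = scale (1/128) (8 * E)"
      unfolding scale_right_distrib[symmetric] that ..
    also have "\<dots> = scale (1/16) E"
      by (simp flip: scale_numeral)
    finally show ?thesis .
  qed
  have z: "\<exists>E. z = scale (1/16) E \<and> E * ?P = ?P * E \<and> E * ?Q = ?Q * E \<and> E * ?S = ?S * E"
    if z: "z \<in> {(A * D - D * A) + A * C - B * A, (B * D - D * B) + B * A - C * B,
            (C * D - D * C) + C * B - A * C}"
  proof -
    have cent: "x * x * ?P = ?P * (x * x)" "x * x * ?Q = ?Q * (x * x)" "x * x * ?S = ?S * (x * x)"
      if "x \<in> {a, b, c, d}" for x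
      using sq[OF that] by (intro commute_square_sum[symmetric]; simp)+
    have E: "((x * x - y * y) * (a * a - w * w - 2 * a + 1)) * Y =
         Y * ((x * x - y * y) * (a * a - w * w - 2 * a + 1))"
      if "x * x * Y = Y * (x * x)" "y * y * Y = Y * (y * y)" "w * w * Y = Y * (w * w)"
        "a * a * Y = Y * (a * a)" "Y * a = a * Y" for x y w Y
    proof -
      have 1: "Y * (x * x - y * y) = (x * x - y * y) * Y"
        using that by (simp add: algebra_simps)
      have 2: "Y * (a * a - w * w - 2 * a + 1) = (a * a - w * w - 2 * a + 1) * Y"
        using that by (simp add: algebra_simps numeral_mults)
      show ?thesis using commute_mult[OF 1 2] by simp
    qed
    have "(A * D - D * A) + A * C - B * A = scale (1/16) ((c * c - d * d) * (a * a - b * b - 2 * a + 1))"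
      unfolding A C B D by (rule comb[OF rel1(4)])
    moreover have "(B * D - D * B) + B * A - C * B = scale (1/16) ((d * d - b * b) * (a * a - c * c - 2 * a + 1))"
      unfolding A C B D rel1(1) by (rule comb[OF rel2(2)])
    moreover have "(C * D - D * C) + C * B - A * C = scale (1/16) ((b * b - c * c) * (a * a - d * d - 2 * a + 1))"
      unfolding A C B D rel1(2) by (rule comb[OF rel3(2)])
    ultimately obtain x y w where zz: "z = scale (1/16) ((x * x - y * y) * (a * a - w * w - 2 * a + 1))"
      and m: "x \<in> {a, b, c, d}" "y \<in> {a, b, c, d}" "w \<in> {a, b, c, d}"
      using z by auto
    have m': "a \<in> {a, b, c, d}" by simp
    show ?thesis
      by (rule exI, intro conjI, rule zz;
          intro E cent[OF m(1)] cent[OF m(2)] cent[OF m(3)] cent[OF m'] rel1(3) rel2(1) rel3(1))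
  qed
  show "z * g = g * z"
    if z': "z \<in> {(A * D - D * A) + A * C - B * A, (B * D - D * B) + B * A - C * B,
            (C * D - D * C) + C * B - A * C}" and g: "g \<in> {A, B, C, D}"
  proof -
    from z[OF z'] obtain E where E: "z = scale (1/16) E" "E * ?P = ?P * E" "E * ?Q = ?Q * E" "E * ?S = ?S * E"
      by blast
    have EX: "E * ?X = ?X * E"
    proof -
      have "E * (?P * ?Q) = (?P * ?Q) * E" "E * (?Q * ?P) = (?Q * ?P) * E"
        using E by (auto intro!: commute_mult)
      then show ?thesis by (simp only: right_diff_distrib left_diff_distrib)
    qed
    have comm: "scale r E * scale s U = scale s U * scale r E" if "E * U = U * E" for r s U
      using that by (simp add: scale_mult_left scale_mult_right mult.commute)
    have one: "E * (U - 1) = (U - 1) * E" if "E * U = U * E" for U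
      using that by (simp add: right_diff_distrib left_diff_distrib)
    show ?thesis
      using g E(2-4) EX unfolding E(1) A B C D by (auto intro!: comm one simp del: scale_scale)
  qed
qed

lemma daha_sum: "daha_t0 + daha_t1 + daha_t0v + daha_t1v + 1 = (0 :: 'f::field_char_0 daha)"
proof -
  interpret abs: algebra_hom free_scale daha_scale "abs_daha :: _ \<Rightarrow> 'f daha"
    by (rule abs_daha_hom)
  have "abs_daha (free_gen T0 + free_gen T1 + free_gen T0v + free_gen T1v + 1) = (0 :: 'f daha)"
    by (rule abs_daha_relation) (simp add: daha_relations_def)
  then show ?thesis
    by (simp add: abs.hom_add abs.hom_one daha_t0_def daha_t1_def daha_t0v_def daha_t1v_def)
qed

lemma daha_square_central:
  "\<forall>x\<in>{daha_t0, daha_t1, daha_t0v, daha_t1v}. \<forall>y\<in>{daha_t0, daha_t1, daha_t0v, daha_t1v}.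
     x * x * y = y * (x * x :: 'f::field_char_0 daha)"
proof (intro ballI)
  fix x y :: "'f daha"
  assume xy: "x \<in> {daha_t0, daha_t1, daha_t0v, daha_t1v}" "y \<in> {daha_t0, daha_t1, daha_t0v, daha_t1v}"
  interpret abs: algebra_hom free_scale daha_scale "abs_daha :: _ \<Rightarrow> 'f daha"
    by (rule abs_daha_hom)
  obtain s t where x: "x = abs_daha (free_gen s)" and y: "y = abs_daha (free_gen t)"
    using xy unfolding daha_t0_def daha_t1_def daha_t0v_def daha_t1v_def by blast
  have "abs_daha (free_gen s * free_gen s * free_gen t - free_gen t * (free_gen s * free_gen s)) =
      (0 :: 'f daha)"
    by (rule abs_daha_relation) (auto simp: daha_relations_def)
  then show "x * x * y = y * (x * x)"
    by (simp add: abs.hom_diff abs.hom_mult x y)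
qed

lemma racah_commutator:
  "racah_A * racah_B - racah_B * racah_A = (racah_scale 2 racah_D :: 'f::field_char_0 racah)"
proof -
  interpret abs: algebra_hom free_scale racah_scale "abs_racah :: _ \<Rightarrow> 'f racah"
    by (rule abs_racah_hom)
  have "abs_racah (free_gen RA * free_gen RB - free_gen RB * free_gen RA - 2 * free_gen RD) =
      (0 :: 'f racah)"
    by (rule abs_racah_relation) (simp add: racah_relations_def Let_def)
  then show ?thesis
    by (simp add: abs.hom_diff abs.hom_mult abs.hom_numeral racah_A_def racah_B_def racah_D_def
        abs.cod.scale_numeral)
qed

definition zeta :: "'f::field_char_0 racah \<Rightarrow> 'f daha" where
  "zeta = (THE h. algebra_hom racah_scale daha_scale h \<and>
     h racah_A = daha_scale (1/4) ((daha_t1v + daha_t0v) * (daha_t1v + daha_t0v + 2)) \<and>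
     h racah_B = daha_scale (1/4) ((daha_t1 + daha_t1v) * (daha_t1 + daha_t1v + 2)) \<and>
     h racah_C = daha_scale (1/4) ((daha_t0v + daha_t1) * (daha_t0v + daha_t1 + 2)))"

lemma zeta_ex1:
  "\<exists>!h. algebra_hom racah_scale daha_scale h \<and>
     h racah_A = daha_scale (1/4) ((daha_t1v + daha_t0v) * (daha_t1v + daha_t0v + 2)) \<and>
     h racah_B = daha_scale (1/4) ((daha_t1 + daha_t1v) * (daha_t1 + daha_t1v + 2)) \<and>
     h racah_C = (daha_scale (1/4) ((daha_t0v + daha_t1) * (daha_t0v + daha_t1 + 2))
       :: 'f::field_char_0 daha)"
    (is "\<exists>!h. ?hom h \<and> h racah_A = ?A \<and> h racah_B = ?B \<and> h racah_C = ?C")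
proof (rule ex_ex1I)
  interpret R: algebra_hom free_scale racah_scale "abs_racah :: _ \<Rightarrow> 'f racah"
    by (rule abs_racah_hom)
  interpret H: assoc_algebra "daha_scale :: 'f \<Rightarrow> _"
    by (rule assoc_algebra_daha)
  let ?D = "daha_scale (1/2) (?A * ?B - ?B * ?A)"
  define im where "im g = (case g of RA \<Rightarrow> ?A | RB \<Rightarrow> ?B | RC \<Rightarrow> ?C | RD \<Rightarrow> ?D)" for g
  define L where "L = free_lift daha_scale im"
  interpret L: algebra_hom free_scale daha_scale L
    unfolding L_def by (rule H.free_lift_hom)
  have Lg: "L (free_gen RA) = ?A" "L (free_gen RB) = ?B" "L (free_gen RC) = ?C" "L (free_gen RD) = ?D"
    by (simp_all add: L_def H.free_lift_gen im_def)
  note rels = racah_from_daha[OF assoc_algebra_daha daha_sum daha_square_central]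
  have Lrel: "L s = 0" if s: "s \<in> racah_relations" for s
  proof -
    consider
        "s = free_gen RA * free_gen RB - free_gen RB * free_gen RA - 2 * free_gen RD"
      | "s = free_gen RB * free_gen RC - free_gen RC * free_gen RB - 2 * free_gen RD"
      | "s = free_gen RC * free_gen RA - free_gen RA * free_gen RC - 2 * free_gen RD"
      | z g where "s = z * g - g * z"
        "z \<in> {(free_gen RA * free_gen RD - free_gen RD * free_gen RA)
                + free_gen RA * free_gen RC - free_gen RB * free_gen RA,
              (free_gen RB * free_gen RD - free_gen RD * free_gen RB)
                + free_gen RB * free_gen RA - free_gen RC * free_gen RB,
              (free_gen RC * free_gen RD - free_gen RD * free_gen RC)
                + free_gen RC * free_gen RB - free_gen RA * free_gen RC}"
        "g \<in> {free_gen RA, free_gen RB, free_gen RC, free_gen RD}"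
      using s unfolding racah_relations_def Let_def
      by (elim UnE) ((elim insertE emptyE; blast) | (elim CollectE exE conjE; blast))+
    then show ?thesis
    proof cases
      case 1
      then show ?thesis using rels(1) by (simp only: L.hom_diff L.hom_mult L.hom_numeral Lg) simp
    next
      case 2
      then show ?thesis using rels(2) by (simp only: L.hom_diff L.hom_mult L.hom_numeral Lg) simp
    next
      case 3
      then show ?thesis using rels(3) by (simp only: L.hom_diff L.hom_mult L.hom_numeral Lg) simp
    next
      case 4
      have "L z \<in> {(?A * ?D - ?D * ?A) + ?A * ?C - ?B * ?A, (?B * ?D - ?D * ?B) + ?B * ?A - ?C * ?B,
            (?C * ?D - ?D * ?C) + ?C * ?B - ?A * ?C}"
        using 4(2) by (elim insertE emptyE) (simp_all only: L.hom_diff L.hom_add L.hom_mult Lg insert_iff simp_thms)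
      moreover have "L g \<in> {?A, ?B, ?C, ?D}"
        using 4(3) by (elim insertE emptyE) (simp_all only: Lg insert_iff simp_thms)
      ultimately have "L z * L g = L g * L z"
        by (rule rels(4))
      then show ?thesis unfolding 4(1) by (simp add: L.hom_diff L.hom_mult)
    qed
  qed
  have Lcong: "L p = L q" if "p - q \<in> two_sided_ideal racah_relations" for p q
    using L.hom_ideal[OF Lrel that] by (simp add: L.hom_diff)
  define h where "h x = L (rep_racah x)" for x
  have habs: "h (abs_racah p) = L p" for p
    unfolding h_def by (rule Lcong) (rule Quotient3_rep_abs[OF Quotient3_racah], simp add: ideal_zero)
  have "?hom h"
  proof unfold_locales
    fix x y :: "'f racah" and c :: 'f
    obtain p where x: "x = abs_racah p" by (metis Quotient3_abs_rep[OF Quotient3_racah])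
    obtain q where y: "y = abs_racah q" by (metis Quotient3_abs_rep[OF Quotient3_racah])
    show "h (x + y) = h x + h y"
      by (simp add: x y habs L.hom_add flip: R.hom_add)
    show "h (x * y) = h x * h y"
      by (simp add: x y habs L.hom_mult flip: R.hom_mult)
    show "h (racah_scale c x) = daha_scale c (h x)"
      by (simp add: x habs L.hom_scale flip: R.hom_scale)
    show "h 1 = 1"
      by (simp add: habs L.hom_one flip: R.hom_one)
  qed
  then show "\<exists>h. ?hom h \<and> h racah_A = ?A \<and> h racah_B = ?B \<and> h racah_C = ?C"
    by (intro exI[of _ h]) (simp only: racah_A_def racah_B_def racah_C_def habs Lg simp_thms)
next
  fix h k :: "'f racah \<Rightarrow> 'f daha"
  assume h: "?hom h \<and> h racah_A = ?A \<and> h racah_B = ?B \<and> h racah_C = ?C"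
    and k: "?hom k \<and> k racah_A = ?A \<and> k racah_B = ?B \<and> k racah_C = ?C"
  interpret R: algebra_hom free_scale racah_scale "abs_racah :: _ \<Rightarrow> 'f racah"
    by (rule abs_racah_hom)
  interpret h: algebra_hom racah_scale daha_scale h using h by blast
  interpret k: algebra_hom racah_scale daha_scale k using k by blast
  have ABC: "h racah_A = k racah_A" "h racah_B = k racah_B" "h racah_C = k racah_C"
    using h k by simp_all
  have D_eq: "racah_D = (racah_scale (1/2) (racah_A * racah_B - racah_B * racah_A) :: 'f racah)"
    unfolding racah_commutator by simp
  have D: "h racah_D = k racah_D"
    by (simp only: D_eq h.hom_scale k.hom_scale h.hom_diff k.hom_diff h.hom_mult k.hom_mult ABC)
  have "(\<lambda>p. h (abs_racah p)) = (\<lambda>p. k (abs_racah p))"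
  proof (rule free_hom_unique)
    show "algebra_hom free_scale daha_scale (\<lambda>p. h (abs_racah p))"
      by unfold_locales
        (simp_all add: R.hom_add R.hom_mult R.hom_scale R.hom_one h.hom_add h.hom_mult h.hom_scale h.hom_one)
    show "algebra_hom free_scale daha_scale (\<lambda>p. k (abs_racah p))"
      by unfold_locales
        (simp_all add: R.hom_add R.hom_mult R.hom_scale R.hom_one k.hom_add k.hom_mult k.hom_scale k.hom_one)
    show "h (abs_racah (free_gen g)) = k (abs_racah (free_gen g))" for g
      using ABC D by (cases g) (simp_all add: racah_A_def racah_B_def racah_C_def racah_D_def)
  qed
  then have "h (abs_racah p) = k (abs_racah p)" for p by meson
  then show "h = k"
    by (metis ext Quotient3_abs_rep[OF Quotient3_racah])
qed

lemmas zeta_props = theI'[OF zeta_ex1, folded zeta_def]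

definition racah_pullback :: "('f::field_char_0 daha \<Rightarrow> 'v \<Rightarrow> 'v) \<Rightarrow> 'f racah \<Rightarrow> 'v \<Rightarrow> 'v" where
  "racah_pullback act = (\<lambda>r. act (zeta r))"

lemma racah_pullback_module:
  assumes "algebra_module daha_scale scaleV act"
  shows "algebra_module racah_scale scaleV (racah_pullback act)"
proof -
  interpret M: algebra_module daha_scale scaleV act by fact
  interpret z: algebra_hom racah_scale daha_scale zeta using zeta_props by blast
  show ?thesis
    by unfold_locales
      (simp_all add: racah_pullback_def z.hom_add z.hom_scale z.hom_mult z.hom_one
        M.act_add_left M.act_add_right M.act_scale M.act_mult M.act_one)
qed

end

theory Submission
  imports Defs
begin

text \<open>
  Write \<open>a, b, c, d\<close> for the actions of \<open>t\<^sub>0, t\<^sub>1, t\<^sub>0\<^sup>\<or>, t\<^sub>1\<^sup>\<or>\<close>; by Schur's lemma their squares are scalars, and the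
  \<open>\<Re>\<close>-submodules are the subspaces stable under \<open>a\<close>, \<open>ab + ba\<close> and \<open>ac + ca\<close>. If \<open>W \<noteq> 0\<close> is such a
  subspace of \<open>V(\<theta>)\<close>, then \<open>W + bW + cW + bcW\<close> is stable under \<open>a, b, c\<close>, hence is all of \<open>V\<close>, and
  \<open>a + \<theta>\<close> maps it into \<open>W\<close>. For \<open>\<theta> \<noteq> 0\<close> this says that \<open>V(\<theta>)\<close> is irreducible. For \<open>a\<^sup>2 = 0\<close> it
  says that every nonzero submodule contains \<open>im a\<close>, and a dual argument puts every proper submodule
  inside \<open>ker a\<close>. Every subspace between \<open>im a\<close> and \<open>ker a\<close> is a submodule, so it remains to see that
  \<open>dim ker a \<le> dim im a + 1\<close>. If this failed, \<open>{v. av = abv = 0}\<close> would have dimension at least 2; a common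
  eigenvector \<open>v\<close> of \<open>a\<close> and \<open>b\<close> in it yields the basis \<open>v, cv, acv, cacv, \<dots>\<close> of \<open>V\<close>, on which \<open>a + b\<close> is
  triangular. This bounds the rank of \<open>a\<close>, and if \<open>dim V\<close> is even, it forces the eigenvalue of \<open>b\<close> to be
  \<open>- dim V / 2\<close> and the space of such \<open>v\<close> to be a line.
\<close>

section \<open>Linear algebra\<close>

context finite_dimensional_vector_space
begin

lemma independent_sequence:
  assumes "\<And>i. i < N \<Longrightarrow> w i \<notin> span (w ` {..<i})"
  shows "independent (w ` {..<N}) \<and> card (w ` {..<N}) = N"
  using assms
proof (induction N)
  case (Suc N)
  then have IH: "independent (w ` {..<N})" "card (w ` {..<N}) = N" and "w N \<notin> span (w ` {..<N})"
    by auto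
  moreover have "w N \<notin> w ` {..<N}"
    using \<open>w N \<notin> span (w ` {..<N})\<close> span_superset[of "w ` {..<N}"] by blast
  ultimately show ?case
    by (simp add: lessThan_Suc independent_insertI)
qed (simp add: independent_empty)

text \<open>Endless independent steps would exceed the dimension. Taking the least dependent index
  keeps all earlier members independent, as the Krylov-type arguments below require.\<close>

lemma sequence_dependent:
  fixes w :: "nat \<Rightarrow> 'b"
  obtains N where "w N \<in> span (w ` {..<N})" "\<And>i. i < N \<Longrightarrow> w i \<notin> span (w ` {..<i})"
proof -
  have "\<exists>N. w N \<in> span (w ` {..<N})"
  proof (rule ccontr)
    assume "\<not> ?thesis"
    then have "independent (w ` {..<Suc dimension}) \<and> card (w ` {..<Suc dimension}) = Suc dimension"
      by (intro independent_sequence) auto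
    then show False
      using independent_card_le_dim[of "w ` {..<Suc dimension}" UNIV] by (auto simp: dimension_def)
  qed
  from LeastI_ex[OF this] show ?thesis
    by (rule that) (rule not_less_Least)
qed

lemma span_sequence:
  fixes w :: "nat \<Rightarrow> 'b"
  assumes "x \<in> span (w ` {..<N})"
  shows "\<exists>r. x = (\<Sum>i<N. scale (r i) (w i))"
  using assms
proof (induction N arbitrary: x)
  case (Suc N)
  then obtain k where "x - scale k (w N) \<in> span (w ` {..<N})"
    by (auto simp: lessThan_Suc span_breakdown_eq)
  then obtain r where "x - scale k (w N) = (\<Sum>i<N. scale (r i) (w i))"
    using Suc.IH by blast
  then have "x = (\<Sum>i<Suc N. scale ((r(N := k)) i) (w i))"
    by (simp add: algebra_simps)
  then show ?case
    by blast
qed simp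

lemma sequence_independentD:
  fixes w :: "nat \<Rightarrow> 'b"
  assumes "\<And>i. i < N \<Longrightarrow> w i \<notin> span (w ` {..<i})"
    and "(\<Sum>i<N. scale (r i) (w i)) = 0" and "i < N"
  shows "r i = 0"
  using assms
proof (induction N arbitrary: i)
  case (Suc N)
  have mem: "(\<Sum>i<N. scale (r i) (w i)) \<in> span (w ` {..<N})"
    by (intro span_sum span_scale span_base) auto
  have eq: "scale (r N) (w N) = - (\<Sum>i<N. scale (r i) (w i))"
    using Suc.prems(2) by (simp add: eq_neg_iff_add_eq_0 add.commute)
  have "r N = 0"
  proof (rule ccontr)
    assume "r N \<noteq> 0"
    then have "w N = scale (inverse (r N)) (scale (r N) (w N))"
      by simp
    then have "w N \<in> span (w ` {..<N})"
      unfolding eq using mem span_scale span_neg by metis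
    then show False using Suc.prems(1)[of N] by simp
  qed
  then show ?case
    using Suc by (cases "i = N") auto
qed simp

text \<open>A basis \<open>B0\<close> of the kernel is extended to a basis \<open>B\<close> of
  \<open>S\<close>; \<open>T\<close> is injective on the span of \<open>C = B - B0\<close>, and the
  images of \<open>C\<close> span the image of \<open>S\<close>. The form relative to
  \<open>S\<close> is later used on the kernel of \<open>a\<close>.\<close>

lemma rank_nullity:
  assumes T: "Vector_Spaces.linear scale scale T" and S: "subspace S"
  shows "dim S = dim (T ` S) + dim {x \<in> S. T x = 0}"
proof -
  interpret T: Vector_Spaces.linear scale scale T by fact
  let ?K = "{x \<in> S. T x = 0}"
  obtain B0 where B0: "B0 \<subseteq> ?K" "independent B0" "?K \<subseteq> span B0"
    using basis_exists[of ?K] by metis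
  then have "B0 \<subseteq> S"
    by blast
  then obtain B where B: "B0 \<subseteq> B" "B \<subseteq> S" "independent B" "S \<subseteq> span B"
    by (rule maximal_independent_subset_extend[OF _ B0(2)])
  define C where "C = B - B0"
  have "subspace ?K"
    using S by (auto simp: subspace_def T.add T.scale)
  then have SB: "span B = S" "span B0 = ?K"
    using span_subspace[OF B(2,4) S] span_subspace[OF B0(1,3)] by auto
  have inj: "inj_on T (span C)"
  proof (rule T.inj_on_iff_eq_0[THEN iffD2])
    show "subspace (span C)" by simp
    show "\<forall>x\<in>span C. T x = 0 \<longrightarrow> x = 0"
    proof (intro ballI impI)
      fix x assume x: "x \<in> span C" "T x = 0"
      have "x \<in> S"
        using x span_mono[of C B] SB by (auto simp: C_def)
      then have "x \<in> span B0"
        using x SB by blast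
      \<comment> \<open>The coordinates of \<open>x\<close> are supported in \<open>C\<close> and
        also in \<open>B0\<close>; these sets are disjoint, so all coordinates vanish.\<close>
      have "representation B x = representation C x" "representation B x = representation B0 x"
        using B(1,3) x(1) \<open>x \<in> span B0\<close> by (auto intro!: representation_extend simp: C_def)
      then have "representation C x = (\<lambda>_. 0)"
        using representation_ne_zero[of C x] representation_ne_zero[of B0 x] by (auto simp: C_def)
      then show "x = 0"
        using sum_nonzero_representation_eq[of C x] x(1) B(3) independent_mono[of B C]
        by (auto simp: C_def)
    qed
  qed
  have "T ` S = span (T ` C)"
  proof -
    have "B = B0 \<union> C" using B C_def by auto
    then have "T ` S = span (T ` B0 \<union> T ` C)"
      using SB by (metis T.span_image image_Un)
    also have "\<dots> = span (T ` C)"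
    proof
      have "T y = 0" if "y \<in> B0" for y
        using that B0 by auto
      then show "span (T ` B0 \<union> T ` C) \<subseteq> span (T ` C)"
        by (intro span_minimal) (auto simp: span_zero intro: span_base)
    qed (simp add: span_mono)
    finally show ?thesis .
  qed
  moreover have "independent C" using B(3) independent_mono[of B C] by (auto simp: C_def)
  ultimately have "dim (T ` S) = card C"
    using inj T.inj_on_span_independent_image
    by (metis T.independent_injective_image card_image dim_span_eq_card_independent inj_on_subset span_superset)
  moreover have "dim S = card B" "dim ?K = card B0"
    using SB B0 B by (metis dim_span_eq_card_independent)+
  moreover have "card B = card C + card B0"
    using B finiteI_independent[OF B(3)] unfolding C_def
    by (metis card_Diff_subset card_mono finite_subset le_add_diff_inverse2)
  ultimately show ?thesis by simp
qed

end

section \<open>Polynomials in an operator, eigenvectors, Schur's lemma\<close>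

definition poly_act ::
    "('f::field \<Rightarrow> 'v::ab_group_add \<Rightarrow> 'v) \<Rightarrow> ('v \<Rightarrow> 'v) \<Rightarrow> 'f poly \<Rightarrow> 'v \<Rightarrow> 'v" where
  "poly_act scale T p x = (\<Sum>i\<le>degree p. scale (coeff p i) ((T ^^ i) x))"

context vector_space
begin

lemma poly_act_superset: "degree p \<le> N \<Longrightarrow> poly_act scale T p x = (\<Sum>i\<le>N. scale (coeff p i) ((T ^^ i) x))"
  unfolding poly_act_def by (intro sum.mono_neutral_left) (auto simp: coeff_eq_0)

lemma poly_act_add: "poly_act scale T (p + q) x = poly_act scale T p x + poly_act scale T q x"
proof -
  let ?N = "max (degree p) (degree q)"
  have "degree (p + q) \<le> ?N" by (rule degree_add_le_max)
  then show ?thesis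
    by (simp add: poly_act_superset[of _ ?N] scale_left_distrib sum.distrib)
qed

lemma poly_act_smult: "poly_act scale T (smult c p) x = scale c (poly_act scale T p x)"
  by (simp add: poly_act_superset[of "smult c p" "degree p"] poly_act_def scale_sum_right degree_smult_le)

lemma poly_act_pCons_0:
  assumes T: "Vector_Spaces.linear scale scale T"
  shows "poly_act scale T (pCons 0 p) x = T (poly_act scale T p x)"
proof -
  interpret T: Vector_Spaces.linear scale scale T by fact
  have "poly_act scale T (pCons 0 p) x = (\<Sum>i\<le>Suc (degree p). scale (coeff (pCons 0 p) i) ((T ^^ i) x))"
    by (rule poly_act_superset) (simp add: degree_pCons_le)
  also have "\<dots> = T (poly_act scale T p x)"
    by (subst sum.atMost_Suc_shift) (simp add: poly_act_def T.sum T.scale)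
  finally show ?thesis .
qed

end

text \<open>Among the nonzero polynomials killing some nonzero vector of \<open>S\<close> take
  \<open>p\<close> of least degree. It has a root \<open>l\<close>; with
  \<open>p = (X - l) q\<close> the vector q(T) x is nonzero by minimality and is killed by
  \<open>T - l\<close>.\<close>

lemma eigenvector_exists:
  fixes scale :: "'f::alg_closed_field \<Rightarrow> 'v::ab_group_add \<Rightarrow> 'v"
  assumes V: "finite_dimensional_vector_space scale Basis"
    and T: "Vector_Spaces.linear scale scale T"
    and S: "module.subspace scale S" "S \<noteq> {0}" "\<And>x. x \<in> S \<Longrightarrow> T x \<in> S"
  obtains v l where "v \<in> S" "v \<noteq> 0" "T v = scale l v"
proof -
  interpret finite_dimensional_vector_space scale Basis by fact
  interpret T: Vector_Spaces.linear scale scale T by fact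
  have pow: "(T ^^ i) x \<in> S" if "x \<in> S" for i x
    using that S(3) by (induction i) auto
  have mem: "poly_act scale T p x \<in> S" if "x \<in> S" for p x
    unfolding poly_act_def using that S(1) by (intro subspace_sum subspace_scale pow) auto
  define P where "P p \<longleftrightarrow> p \<noteq> 0 \<and> (\<exists>x\<in>S. x \<noteq> 0 \<and> poly_act scale T p x = 0)" for p
  have "\<exists>p. P p"
  proof -
    obtain x where x: "x \<in> S" "x \<noteq> 0"
      using S subspace_0 by blast
    obtain N where "(T ^^ N) x \<in> span ((\<lambda>i. (T ^^ i) x) ` {..<N})"
      by (rule sequence_dependent)
    then obtain r where r: "(T ^^ N) x = (\<Sum>i<N. scale (r i) ((T ^^ i) x))"
      using span_sequence by blast
    \<comment> \<open>The monic polynomial of the relation expressing \<open>(T ^^ N) x\<close> by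
      lower powers.\<close>
    define p where "p = monom 1 N - (\<Sum>i<N. monom (r i) i)"
    have c: "coeff p i = (if i = N then 1 else if i < N then - r i else 0)" for i
      by (auto simp: p_def coeff_sum)
    then have "p \<noteq> 0" by (metis coeff_0 zero_neq_one)
    moreover have "degree p \<le> N"
      by (rule degree_le) (simp add: c)
    then have "poly_act scale T p x = (\<Sum>i\<le>N. scale (coeff p i) ((T ^^ i) x))"
      by (rule poly_act_superset)
    then have "poly_act scale T p x = 0"
      by (simp add: c r sum_negf flip: lessThan_Suc_atMost)
    ultimately show ?thesis using x unfolding P_def by blast
  qed
  then obtain p0 where "P p0" ..
  then obtain p where p: "P p" and "\<And>q. P q \<Longrightarrow> degree p \<le> degree q"
    using ex_has_least_nat[of P p0 degree] by blast
  then have min: "\<not> P q" if "degree q < degree p" for q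
    using that by (meson not_less)
  obtain x where x: "x \<in> S" "x \<noteq> 0" "poly_act scale T p x = 0" and "p \<noteq> 0"
    using p unfolding P_def by blast
  have "degree p > 0"
  proof (rule ccontr)
    assume "\<not> degree p > 0"
    then have "poly_act scale T p x = scale (lead_coeff p) x"
      by (simp add: poly_act_def)
    then show False
      using x \<open>p \<noteq> 0\<close> by simp
  qed
  then obtain l where "poly p l = 0"
    using alg_closed_imp_poly_has_root by blast
  then obtain q where q: "p = [:- l, 1:] * q"
    by (metis dvdE poly_eq_0_iff_dvd)
  have "q \<noteq> 0" using q \<open>p \<noteq> 0\<close> by auto
  then have "degree q < degree p"
    unfolding q by (subst degree_mult_eq) auto
  then have "poly_act scale T q x \<noteq> 0"
    using min \<open>q \<noteq> 0\<close> x unfolding P_def by blast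
  moreover have "p = pCons 0 q + smult (- l) q" unfolding q by simp
  then have "T (poly_act scale T q x) = scale l (poly_act scale T q x)"
    using x(3) by (simp add: poly_act_add poly_act_smult poly_act_pCons_0[OF T] del: smult_minus_left)
  ultimately show ?thesis
    using that mem[OF x(1)] by blast
qed

text \<open>Schur's lemma: an eigenspace of \<open>T\<close> is stable under every operator in
  \<open>Ts\<close>. Allowing any set \<open>Ts\<close> makes it serve for the algebra generators
  and again for \<open>a\<close>, \<open>b\<close>, \<open>c\<close> alone.\<close>

lemma commuting_operator_scalar:
  fixes scale :: "'f::alg_closed_field \<Rightarrow> 'v::ab_group_add \<Rightarrow> 'v"
  assumes V: "finite_dimensional_vector_space scale Basis" "\<exists>x::'v. x \<noteq> 0"
    and irred: "\<And>W. \<lbrakk>module.subspace scale W; \<And>S x. \<lbrakk>S \<in> Ts; x \<in> W\<rbrakk> \<Longrightarrow> S x \<in> W; W \<noteq> {0}\<rbrakk> \<Longrightarrow> W = UNIV"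
    and T: "Vector_Spaces.linear scale scale T"
    and comm: "\<And>S x. S \<in> Ts \<Longrightarrow> T (S x) = S (T x)"
    and lin: "\<And>S r x. S \<in> Ts \<Longrightarrow> S (scale r x) = scale r (S x)"
  obtains l where "\<And>x. T x = scale l x"
proof -
  interpret finite_dimensional_vector_space scale Basis by fact
  interpret T: Vector_Spaces.linear scale scale T by fact
  have "(UNIV :: 'v set) \<noteq> {0}"
    using V(2) by blast
  then obtain v l where v: "v \<noteq> 0" "T v = scale l v"
    by (rule eigenvector_exists[OF V(1) T subspace_UNIV]) auto
  have "{x. T x = scale l x} = UNIV"
  proof (rule irred)
    show "subspace {x. T x = scale l x}"
      by (auto simp: subspace_def T.add T.scale scale_right_distrib mult.commute)
    show "S x \<in> {x. T x = scale l x}" if "S \<in> Ts" "x \<in> {x. T x = scale l x}" for S x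
      using that by (simp add: comm lin)
    show "{x. T x = scale l x} \<noteq> {0}"
      using v by blast
  qed
  then show ?thesis using that by blast
qed

section \<open>Four operators with scalar squares\<close>

text \<open>\<open>d_eq\<close> is the defining linear relation. It makes stability under
  \<open>a\<close>, \<open>b\<close>, \<open>c\<close> entail stability under \<open>d\<close>,
  which is why irreducibility is stated for these three.\<close>

locale daha_operators =
  finite_dimensional_vector_space scale Basis
    + a: Vector_Spaces.linear scale scale a
    + b: Vector_Spaces.linear scale scale b
    + c: Vector_Spaces.linear scale scale c
  for scale :: "'f::{alg_closed_field, field_char_0} \<Rightarrow> 'v::ab_group_add \<Rightarrow> 'v"
    and Basis :: "'v set" and a b c :: "'v \<Rightarrow> 'v" +
  fixes ka kb kc kd :: 'f and d :: "'v \<Rightarrow> 'v"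
  assumes aa: "a (a x) = scale ka x"
    and bb: "b (b x) = scale kb x"
    and cc: "c (c x) = scale kc x"
    and dd: "d (d x) = scale kd x"
    and d_eq: "d x = - (x + a x + b x + c x)"
    and nontrivial: "\<exists>x::'v. x \<noteq> 0"
    and irreducible: "\<lbrakk>subspace W; \<And>x. x \<in> W \<Longrightarrow> a x \<in> W; \<And>x. x \<in> W \<Longrightarrow> b x \<in> W;
      \<And>x. x \<in> W \<Longrightarrow> c x \<in> W; W \<noteq> {0}\<rbrakk> \<Longrightarrow> W = UNIV"
begin

lemma halve: "subspace W \<Longrightarrow> x + x \<in> W \<Longrightarrow> x \<in> W"
  using subspace_scale[of W "x + x" "1/2"]
  by (simp add: scale_right_distrib flip: scale_left_distrib)

lemma span_stable:
  assumes "Vector_Spaces.linear scale scale T" "\<And>x. x \<in> S \<Longrightarrow> T x \<in> span S" "x \<in> span S"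
  shows "T x \<in> span S"
proof -
  interpret T: Vector_Spaces.linear scale scale T by fact
  have "span S \<subseteq> {x. T x \<in> span S}"
    using assms(2) T.subspace_linear_preimage[of "span S"] by (intro span_minimal) auto
  then show ?thesis using assms(3) by blast
qed

text \<open>By \<open>c_b\<close> below, \<open>bc + cb\<close> is a combination of \<open>1, a, b, c\<close> and the following two anticommutators. This is
  why stability under the latter and \<open>a\<close> is all that \<open>A, B, C\<close> can detect.\<close>

definition ab :: "'v \<Rightarrow> 'v" where "ab x = a (b x) + b (a x)"
definition ac :: "'v \<Rightarrow> 'v" where "ac x = a (c x) + c (a x)"

lemma c_b:
  "c (b x) = scale (kd - 1 - ka - kb - kc) x - a x - a x - b x - b x - c x - c x - ab x - ac x - b (c x)"
proof -
  \<comment> \<open>The operator \<open>1 + a + b + c\<close> is \<open>- d\<close>, so its square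
    is \<open>kd\<close>; the rest is expanding and solving for \<open>c (b x)\<close>.\<close>
  have "scale kd x = x + a x + b x + c x + a (x + a x + b x + c x) + b (x + a x + b x + c x)
      + c (x + a x + b x + c x)"
    using dd[of x] unfolding d_eq
    by (simp add: a.neg b.neg c.neg a.add b.add c.add a.diff b.diff c.diff algebra_simps)
  also have "\<dots> = x + a x + a x + b x + b x + c x + c x + scale ka x + scale kb x + scale kc x
      + ab x + ac x + b (c x) + c (b x)"
    by (simp add: a.add b.add c.add aa bb cc ab_def ac_def algebra_simps)
  finally show ?thesis
    by (simp add: algebra_simps)
qed

section \<open>Commutation rules of the anticommutators\<close>

lemma ab_lin: "ab (x + y) = ab x + ab y" "ab (x - y) = ab x - ab y" "ab (scale r x) = scale r (ab x)"
  "ac (x + y) = ac x + ac y" "ac (x - y) = ac x - ac y" "ac (scale r x) = scale r (ac x)"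
  by (simp_all add: ab_def ac_def a.add b.add c.add a.diff b.diff c.diff a.scale b.scale c.scale
      algebra_simps)

text \<open>\<open>u v + v u\<close> commutes with \<open>u\<close> whenever the square of
  \<open>u\<close> commutes with \<open>v\<close>; here the squares are scalars.\<close>

lemma ab_a: "ab (a x) = a (ab x)" and ab_b: "ab (b x) = b (ab x)"
  and ac_a: "ac (a x) = a (ac x)" and ac_c: "ac (c x) = c (ac x)"
  by (simp_all add: ab_def ac_def a.add b.add c.add a.scale b.scale c.scale aa bb cc add.commute)

text \<open>Multiply \<open>c_b\<close> by \<open>c\<close> on the right and on the left. Since
  \<open>c\<close> has a scalar square, comparing the two leaves the commutator of \<open>ab\<close>
  and \<open>c\<close> as twice [c, a + b].\<close>

lemma ab_c: "ab (c x) = c (ab x) + (c (a x) - a (c x) + c (b x) - b (c x))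
    + (c (a x) - a (c x) + c (b x) - b (c x))"
proof -
  have "c (b (c x)) = scale (kd - 1 - ka - kb - kc) (c x) - a (c x) - a (c x) - b (c x) - b (c x)
      - scale kc x - scale kc x - ab (c x) - c (ac x) - scale kc (b x)"
    using c_b[of "c x"] by (simp add: cc ac_c b.scale)
  moreover have "c (c (b x)) = scale (kd - 1 - ka - kb - kc) (c x) - c (a x) - c (a x) - c (b x) - c (b x)
      - scale kc x - scale kc x - c (ab x) - c (ac x) - c (b (c x))"
    by (subst c_b) (simp add: c.diff c.scale cc)
  ultimately have "scale kc (b x) = scale (kd - 1 - ka - kb - kc) (c x) - c (a x) - c (a x) - c (b x) - c (b x)
      - scale kc x - scale kc x - c (ab x) - c (ac x) - (scale (kd - 1 - ka - kb - kc) (c x) - a (c x) - a (c x) - b (c x) - b (c x)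
      - scale kc x - scale kc x - ab (c x) - c (ac x) - scale kc (b x))"
    by (simp add: cc)
  then have "0 = - c (a x) - c (a x) - c (b x) - c (b x) - c (ab x) + a (c x) + a (c x) + b (c x) + b (c x) + ab (c x)"
    by (simp add: algebra_simps)
  then show ?thesis
    by (simp add: algebra_simps)
qed

text \<open>As \<open>ab\<close> commutes with \<open>a\<close>, the left side is the anticommutator
  of \<open>a\<close> with [ab, c] from \<open>ab_c\<close>. The part [c, a] drops out: it
  anticommutes with \<open>a\<close>, whose square is scalar. What remains gives access to
  \<open>a\<close> on [c, b].\<close>

lemma ab_ac_commutator: "ab (ac x) - ac (ab x) =
    (a (c (b x) - b (c x)) + (c (b (a x)) - b (c (a x))))
    + (a (c (b x) - b (c x)) + (c (b (a x)) - b (c (a x))))"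
proof -
  let ?u = "\<lambda>x. c (a x) - a (c x) + c (b x) - b (c x)"
  have "ab (ac x) - ac (ab x) = a (ab (c x) - c (ab x)) + (ab (c (a x)) - c (ab (a x)))"
    unfolding ac_def by (simp add: ab_lin ab_a a.diff)
  also have "\<dots> = a (?u x + ?u x) + (?u (a x) + ?u (a x))"
    unfolding ab_c by (simp add: algebra_simps)
  also have "\<dots> = (a (c (b x) - b (c x)) + (c (b (a x)) - b (c (a x))))
    + (a (c (b x) - b (c x)) + (c (b (a x)) - b (c (a x))))"
    by (simp add: a.add a.diff c.scale aa algebra_simps)
  finally show ?thesis .
qed

section \<open>Subspaces stable under \<open>a\<close>, \<open>ab\<close> and
  \<open>ac\<close>\<close>

definition racah_stable :: "'v set \<Rightarrow> bool" where
  "racah_stable W \<longleftrightarrow> subspace W \<and> (\<forall>x\<in>W. a x \<in> W \<and> ab x \<in> W \<and> ac x \<in> W)"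

lemma racah_stableD:
  assumes "racah_stable W"
  shows "subspace W" "x \<in> W \<Longrightarrow> a x \<in> W" "x \<in> W \<Longrightarrow> ab x \<in> W" "x \<in> W \<Longrightarrow> ac x \<in> W"
  using assms by (auto simp: racah_stable_def)

text \<open>On \<open>W\<close> the operator \<open>a\<close> is \<open>\<theta>\<close>, so
  \<open>a + \<theta>\<close> sends \<open>b x\<close> to \<open>ab x\<close> and \<open>c x\<close>
  to \<open>ac x\<close>, back into \<open>W\<close>. The span of \<open>G\<close> is stable because
  \<open>c_b\<close> and \<open>ab_c\<close> reorder the products that seem to leave it;
  irreducibility makes it the whole space.\<close>

lemma racah_stable_absorbs:
  assumes W: "racah_stable W" "W \<noteq> {0}" and eig: "\<And>x. x \<in> W \<Longrightarrow> a x = scale \<theta> x" "ka = \<theta> * \<theta>"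
  shows "a v + scale \<theta> v \<in> W"
proof -
  define G where "G = W \<union> b ` W \<union> c ` W \<union> (\<lambda>x. b (c x)) ` W"
  note W' = racah_stableD[OF W(1)]
  note closed = span_add span_diff span_scale span_neg
  have g: "x \<in> span G" "b x \<in> span G" "c x \<in> span G" "b (c x) \<in> span G" if "x \<in> W" for x
    using that by (auto simp: G_def intro: span_base)
  have cb: "c (b x) \<in> span G" if "x \<in> W" for x
    unfolding c_b[of x] using that by (simp add: closed g W')
  have "a (b x) = ab x - scale \<theta> (b x)" if "x \<in> W" for x
    using that by (simp add: ab_def eig b.scale)
  then have ab: "a (b x) \<in> span G" if "x \<in> W" for x
    using that by (simp add: closed g W')
  have "a (c x) = ac x - scale \<theta> (c x)" if "x \<in> W" for x
    using that by (simp add: ac_def eig c.scale)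
  then have ac: "a (c x) \<in> span G" if "x \<in> W" for x
    using that by (simp add: closed g W')
  have abc: "ab (c x) \<in> span G" if "x \<in> W" for x
    unfolding ab_c using that by (simp add: closed g W' ac cb)
  have cbc: "c (b (c x)) \<in> span G" if "x \<in> W" for x
    unfolding c_b[of "c x"] ac_c cc using that by (simp add: b.scale closed g W' ac abc)
  have "a (b (c x)) = ab (c x) - b (ac x) + scale \<theta> (b (c x))" if "x \<in> W" for x
    using that by (simp add: ab_def ac_def eig b.add b.scale c.scale)
  then have abc': "a (b (c x)) \<in> span G" if "x \<in> W" for x
    using that by (simp add: closed g W' abc)
  have G_cases: "T x \<in> span G"
    if "\<And>y. y \<in> W \<Longrightarrow> T y \<in> span G \<and> T (b y) \<in> span G \<and> T (c y) \<in> span G \<and> T (b (c y)) \<in> span G"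
      and "Vector_Spaces.linear scale scale T" "x \<in> span G" for T x
    using that(2) _ that(3) by (rule span_stable) (use that(1) in \<open>auto simp: G_def\<close>)
  have "span G = UNIV"
  proof (rule irreducible)
    show "a x \<in> span G" if "x \<in> span G" for x
      using _ a.linear_axioms that
      by (rule G_cases) (auto simp: W' g ab ac abc')
    show "b x \<in> span G" if "x \<in> span G" for x
      using _ b.linear_axioms that
      by (rule G_cases) (auto simp: bb span_scale W' g)
    show "c x \<in> span G" if "x \<in> span G" for x
      using _ c.linear_axioms that
      by (rule G_cases) (auto simp: cc span_scale W' g cb cbc)
    show "span G \<noteq> {0}"
      using W W' g(1) subspace_0 by blast
  qed simp
  moreover have "G \<subseteq> {x. a x + scale \<theta> x \<in> W}"
  proof -
    note closed = subspace_add[OF W'(1)] subspace_diff[OF W'(1)] subspace_scale[OF W'(1)]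
    have 1: "a x + scale \<theta> x \<in> W" if "x \<in> W" for x
      using that by (simp add: closed W')
    have 2: "a (b x) + scale \<theta> (b x) \<in> W" if "x \<in> W" for x
      using W'(3)[OF that] that by (simp add: ab_def eig b.scale)
    have 3: "a (c x) + scale \<theta> (c x) \<in> W" if "x \<in> W" for x
      using W'(4)[OF that] that by (simp add: ac_def eig c.scale)
    \<comment> \<open>\<open>b (c x)\<close> is half of \<open>?s - ?t\<close>. For
      \<open>?t\<close> the claim follows from \<open>ab_ac_commutator\<close>; \<open>?s\<close> is
      reduced by \<open>c_b\<close> to the three cases above.\<close>
    have 4: "a (b (c x)) + scale \<theta> (b (c x)) \<in> W" if x: "x \<in> W" for x
    proof -
      let ?s = "c (b x) + b (c x)" and ?t = "c (b x) - b (c x)"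
      have "ab (ac x) - ac (ab x) \<in> W"
        using x by (simp add: closed W')
      then have "(a ?t + scale \<theta> ?t) + (a ?t + scale \<theta> ?t) \<in> W"
        unfolding ab_ac_commutator eig(1)[OF x] by (simp add: b.scale c.scale scale_right_diff_distrib)
      then have "a ?t + scale \<theta> ?t \<in> W"
        by (rule halve[OF W'(1)])
      moreover have "a ?s + scale \<theta> ?s \<in> W"
      proof -
        let ?z = "scale (kd - 1 - ka - kb - kc) x - a x - a x - ab x - ac x"
        have s: "?s = ?z - b x - b x - c x - c x"
          unfolding c_b[of x] by simp
        have z: "?z \<in> W"
          using x by (simp add: closed W')
        have "a (?z - b x - b x - c x - c x) + scale \<theta> (?z - b x - b x - c x - c x)
          = (a ?z + scale \<theta> ?z) - (a (b x) + scale \<theta> (b x)) - (a (b x) + scale \<theta> (b x))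
           - (a (c x) + scale \<theta> (c x)) - (a (c x) + scale \<theta> (c x))"
          by (simp only: a.diff scale_right_diff_distrib) simp
        also have "\<dots> \<in> W"
          using 1[OF z] 2[OF x] 3[OF x] by (simp only: closed(2))
        finally show ?thesis unfolding s .
      qed
      ultimately have "(a ?s + scale \<theta> ?s) - (a ?t + scale \<theta> ?t) \<in> W"
        by (rule closed(2)[rotated])
      moreover have "(a ?s + scale \<theta> ?s) - (a ?t + scale \<theta> ?t)
          = (a (b (c x)) + scale \<theta> (b (c x))) + (a (b (c x)) + scale \<theta> (b (c x)))"
        by (simp add: a.add a.diff algebra_simps)
      ultimately have "(a (b (c x)) + scale \<theta> (b (c x))) + (a (b (c x)) + scale \<theta> (b (c x))) \<in> W"
        by (simp only:)
      then show ?thesis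
        by (rule halve[OF W'(1)])
    qed
    show ?thesis
      using 1 2 3 4 by (auto simp: G_def)
  qed
  moreover have "subspace {x. a x + scale \<theta> x \<in> W}"
  proof -
    interpret e: Vector_Spaces.linear scale scale "\<lambda>x. a x + scale \<theta> x"
      by unfold_locales (simp_all add: a.add a.scale algebra_simps)
    show ?thesis
      by (rule e.subspace_linear_preimage) (rule W')
  qed
  ultimately show ?thesis
    using span_minimal by blast
qed


lemma dim_UNIV_pos: "dim (UNIV :: 'v set) > 0"
  using nontrivial dim_eq_0[of UNIV] by (auto simp del: dim_eq_0 dim_UNIV)

text \<open>Dual to \<open>racah_stable_absorbs\<close>: the set \<open>M\<close> in the proof is stable under \<open>a, b, c\<close> and proper, hence zero.\<close>

lemma racah_stable_subset_kernel:
  assumes nilp: "ka = 0" and U: "racah_stable U" "\<And>x. a x \<in> U" "U \<noteq> UNIV" and u: "u \<in> U"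
  shows "a u = 0"
proof -
  define M where "M = {v \<in> U. b v \<in> U \<and> c v \<in> U \<and> c (b v) \<in> U}"
  note U' = racah_stableD[OF U(1)]
  note closed = subspace_add[OF U'(1)] subspace_diff[OF U'(1)] subspace_scale[OF U'(1)]
  have a0: "a (a x) = 0" for x
    by (simp add: aa nilp)
  have ba: "b (a x) = ab x - a (b x)" for x
    by (simp add: ab_def)
  have ca: "c (a x) = ac x - a (c x)" for x
    by (simp add: ac_def)
  have bc: "b (c x) = scale (kd - 1 - ka - kb - kc) x - a x - a x - b x - b x - c x - c x
      - ab x - ac x - c (b x)" for x
    using c_b[of x] by (simp add: algebra_simps)
  have "M = UNIV \<or> M = {0}"
  proof (rule disjCI, rule irreducible)
    show "subspace M"
      unfolding M_def subspace_def using U'(1)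
      by (auto simp: b.add c.add b.scale c.scale closed subspace_0)
    show "a x \<in> M" if x: "x \<in> M" for x
    proof -
      \<comment> \<open>Membership of \<open>c (ab x)\<close> comes from trading it for
        \<open>ab (c x)\<close> by \<open>ab_c\<close>; writing
        \<open>b (a x) = ab x - a (b x)\<close> then reaches \<open>c (b (a x))\<close>.\<close>
      have "c (ab x) = ab (c x) - (c (a x) - a (c x) + c (b x) - b (c x))
           - (c (a x) - a (c x) + c (b x) - b (c x))"
        using ab_c[of x] by (simp add: algebra_simps)
      then have "c (b (a x)) = ab (c x) - (c (a x) - a (c x) + c (b x) - b (c x))
           - (c (a x) - a (c x) + c (b x) - b (c x)) - (ac (b x) - a (c (b x)))"
        by (simp add: ba c.diff ca)
      then show ?thesis
        using x by (simp add: M_def U' U(2) ba ca bc closed)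
    qed
    show "b x \<in> M" if "x \<in> M" for x
      using that by (simp add: M_def bb closed c.scale)
    show "c x \<in> M" if x: "x \<in> M" for x
    proof -
      have "b (c x) \<in> U"
        using x by (simp add: M_def bc closed U' U(2))
      then have "c (b (c x)) \<in> U"
        unfolding c_b[of "c x"] using x by (simp add: M_def cc b.scale closed U' U(2) \<open>b (c x) \<in> U\<close>)
      then show ?thesis
        using x \<open>b (c x) \<in> U\<close> by (simp add: M_def cc closed)
    qed
  qed
  then have "M = {0}"
    using U(3) by (auto simp: M_def)
  \<comment> \<open>The hard condition for \<open>a u \<in> M\<close>. As \<open>U\<close> contains
    the image of \<open>a\<close>, the sum of \<open>c (b (a u))\<close> and
    \<open>b (c (a u))\<close> is handled by \<open>c_b\<close> and their difference by
    \<open>ab_ac_commutator\<close>; adding both gives twice the vector.\<close>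
  have "c (b (a u)) \<in> U"
  proof -
    have "c (b (a u)) + b (c (a u)) \<in> U"
      unfolding c_b[of "a u"] by (simp add: ba ca U' u U(2) closed a0 ab_a ac_a)
    moreover have "c (b (a u)) - b (c (a u)) \<in> U"
    proof -
      have "(ab (ac u) - ac (ab u)) - a (c (b u) - b (c u)) - a (c (b u) - b (c u)) \<in> U"
        by (simp add: U' u U(2) closed)
      then have "(c (b (a u)) - b (c (a u))) + (c (b (a u)) - b (c (a u))) \<in> U"
        unfolding ab_ac_commutator by (simp add: algebra_simps)
      then show ?thesis
        by (rule halve[OF U'(1)])
    qed
    ultimately have "(c (b (a u)) + b (c (a u))) + (c (b (a u)) - b (c (a u))) \<in> U"
      by (rule closed(1))
    then have "c (b (a u)) + c (b (a u)) \<in> U"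
      by simp
    then show ?thesis
      by (rule halve[OF U'(1)])
  qed
  then have "a u \<in> M"
    using u by (simp add: M_def U(2) ba ca closed U')
  then show ?thesis
    using \<open>M = {0}\<close> by simp
qed

subsection \<open>The basis generated by a common eigenvector\<close>

primrec chain :: "nat \<Rightarrow> 'v \<Rightarrow> 'v" where
  "chain 0 v = v"
| "chain (Suc i) v = (if even i then c (chain i v) else a (chain i v))"

lemma chain_lin: "chain i (x - y) = chain i x - chain i y" "chain i (scale r x) = scale r (chain i x)"
  by (induction i) (simp_all add: a.diff c.diff a.scale c.scale)

text \<open>The diagonal entries of the triangular matrix of \<open>a + b\<close> in the basis given by \<open>chain\<close>.\<close>

definition weight :: "'f \<Rightarrow> nat \<Rightarrow> 'f" where
  "weight \<beta> i = (if even i then \<beta> + of_nat i else - \<beta> - of_nat (i + 1))"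

context
  fixes v :: 'v and \<beta> :: 'f
  assumes nilp: "ka = 0" and v: "v \<noteq> 0" "a v = 0" "b v = scale \<beta> v"
begin

definition flag :: "nat \<Rightarrow> 'v set" where
  "flag N = span ((\<lambda>i. chain i v) ` {..<N})"

lemma flag_mono: "M \<le> N \<Longrightarrow> flag M \<subseteq> flag N"
  unfolding flag_def by (intro span_mono) auto

lemma chain_in_flag: "i < N \<Longrightarrow> chain i v \<in> flag N"
  unfolding flag_def by (intro span_base) auto

lemma subspace_flag: "subspace (flag N)"
  by (simp add: flag_def)

lemmas flag_closed = subspace_add[OF subspace_flag] subspace_diff[OF subspace_flag]
  subspace_scale[OF subspace_flag] subspace_0[OF subspace_flag]

lemma flag_map:
  assumes "Vector_Spaces.linear scale scale T" "\<And>i. i < M \<Longrightarrow> T (chain i v) \<in> flag N" "x \<in> flag M"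
  shows "T x \<in> flag N"
proof -
  interpret T: Vector_Spaces.linear scale scale T by fact
  have "flag M \<subseteq> {x. T x \<in> flag N}"
    unfolding flag_def using assms(2) T.subspace_linear_preimage[OF subspace_flag[of N]]
    by (intro span_minimal) (auto simp: flag_def)
  then show ?thesis using assms(3) by blast
qed

lemma a_chain: "a (chain i v) = (if even i then 0 else chain (Suc i) v)"
  by (cases i) (simp_all add: aa nilp v(2))

lemma c_chain: "c (chain i v) = (if even i then chain (Suc i) v else scale kc (chain (i - 1) v))"
  by (cases i) (simp_all add: cc)

lemma a_chain_flag: "chain (Suc i) v \<in> flag N \<Longrightarrow> a (chain i v) \<in> flag N"
  by (simp add: a_chain flag_closed del: chain.simps)

lemma c_chain_flag: "chain (Suc i) v \<in> flag N \<Longrightarrow> i \<le> N \<Longrightarrow> c (chain i v) \<in> flag N"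
  by (cases "even i") (auto simp only: c_chain if_True if_False intro!: flag_closed chain_in_flag dest: odd_pos)

text \<open>\<open>X\<close> stands for \<open>a + b\<close>. Since \<open>a\<close> squares to
  zero, \<open>X\<close> squares to \<open>ab + kb\<close>, and \<open>c_b\<close> turns into a rule
  moving \<open>X\<close> past \<open>c\<close>; \<open>X_a\<close> moves it past \<open>a\<close>.
  These are the two letters that build \<open>chain\<close>.\<close>

lemma X_c: "a (c x) + b (c x) =
    scale (kd - kc - 1) x - c (a x + b x) - c x - c x - (a x + b x) - (a x + b x) - (a (a x + b x) + b (a x + b x))"
proof -
  have "a (a x + b x) + b (a x + b x) = ab x + scale kb x"
    by (simp add: ab_def a.add b.add aa bb nilp)
  then show ?thesis
    using c_b[of x] by (simp add: ac_def nilp c.add algebra_simps)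
qed

lemma X_a: "a (a x) + b (a x) = (a (a x + b x) + b (a x + b x)) - scale kb x - a (a x + b x)"
  by (simp add: a.add b.add aa bb nilp)

lemma X_linear: "Vector_Spaces.linear scale scale (\<lambda>x. a x + b x)"
  by unfold_locales (simp_all add: a.add b.add a.scale b.scale algebra_simps)

lemma a_flag: "x \<in> flag N \<Longrightarrow> a x \<in> flag (Suc N)"
  using a.linear_axioms by (rule flag_map) (auto intro!: a_chain_flag chain_in_flag)

lemma c_flag: "x \<in> flag N \<Longrightarrow> c x \<in> flag (Suc N)"
  using c.linear_axioms by (rule flag_map) (auto intro!: c_chain_flag chain_in_flag)

text \<open>Modulo earlier vectors \<open>X_c\<close> reads X c = - c X - 2 c and \<open>X_a\<close>
  reads X a = - a X, so a weight w becomes - w - 2 after \<open>c\<close> and - w after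
  \<open>a\<close>. The induction is strong because the square of \<open>X\<close> occurs too and
  must stay in the flag.\<close>

lemma X_chain: "a (chain i v) + b (chain i v) - scale (weight \<beta> i) (chain i v) \<in> flag i"
proof (induction i rule: less_induct)
  case (less i)
  show ?case
  proof (cases i)
    case 0
    then show ?thesis by (simp add: v weight_def flag_def)
  next
    case (Suc j)
    let ?X = "\<lambda>x. a x + b x" and ?w = "chain j v"
    define f where "f = ?X ?w - scale (weight \<beta> j) ?w"
    have f: "?X ?w = scale (weight \<beta> j) ?w + f" by (simp add: f_def)
    have "f \<in> flag j"
      unfolding f_def using less Suc by simp
    have mem: "?w \<in> flag i"
      by (simp add: Suc chain_in_flag)
    have Xk: "?X (chain k v) \<in> flag i" if "k < i" for k
    proof -
      have "?X (chain k v) - scale (weight \<beta> k) (chain k v) \<in> flag i"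
        using less[OF that] flag_mono[of k i] that by auto
      from flag_closed(1)[OF this flag_closed(3)[OF chain_in_flag[OF that], of "weight \<beta> k"]]
      show ?thesis by simp
    qed
    have X: "?X x \<in> flag i" if "x \<in> flag i" for x
      by (rule flag_map[OF X_linear Xk that])
    have XX: "?X (?X ?w) \<in> flag i"
      by (intro X mem)
    show ?thesis
    proof (cases "even j")
      case True
      have w: "chain i v = c ?w" "weight \<beta> i = - weight \<beta> j - 1 - 1"
        using True by (simp_all add: Suc weight_def)
      have cX: "c (?X ?w) = scale (weight \<beta> j) (c ?w) + c f"
        unfolding f by (simp add: c.add c.scale)
      have "?X (chain i v) - scale (weight \<beta> i) (chain i v) =
          scale (kd - kc - 1) ?w - ?X ?w - ?X ?w - ?X (?X ?w) - c f"
        unfolding w X_c cX scale_left_diff_distrib scale_minus_left scale_one by (simp add: algebra_simps)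
      also have "\<dots> \<in> flag i"
        using \<open>f \<in> flag j\<close> Suc c_flag by (intro flag_closed mem X XX) auto
      finally show ?thesis .
    next
      case False
      have w: "chain i v = a ?w" "weight \<beta> i = - weight \<beta> j"
        using False by (simp_all add: Suc weight_def)
      have aX: "a (?X ?w) = scale (weight \<beta> j) (a ?w) + a f"
        unfolding f by (simp add: a.add a.scale)
      have "?X (chain i v) - scale (weight \<beta> i) (chain i v) = ?X (?X ?w) - scale kb ?w - a f"
        unfolding w X_a aX by simp
      also have "\<dots> \<in> flag i"
        using \<open>f \<in> flag j\<close> Suc a_flag by (intro flag_closed mem XX) auto
      finally show ?thesis .
    qed
  qed
qed

lemma X_flag: "x \<in> flag N \<Longrightarrow> a x + b x \<in> flag N"
proof (rule flag_map[OF X_linear])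
  fix i assume "i < N"
  then have "a (chain i v) + b (chain i v) - scale (weight \<beta> i) (chain i v) \<in> flag N"
    using X_chain[of i] flag_mono[of i N] by auto
  from flag_closed(1)[OF this flag_closed(3)[OF chain_in_flag[OF \<open>i < N\<close>], of "weight \<beta> i"]]
  show "a (chain i v) + b (chain i v) \<in> flag N" by simp
qed

text \<open>Stop at the first dependent vector, of index \<open>N\<close>. Then
  \<open>flag N\<close> is stable under \<open>a\<close>, \<open>c\<close> and \<open>X\<close>,
  hence under \<open>b = X - a\<close>, so it is the whole space and \<open>N\<close> is the
  dimension.\<close>

lemma chain_basis:
  shows "flag (dim UNIV) = UNIV" "\<And>i. i < dim UNIV \<Longrightarrow> chain i v \<notin> flag i"
proof -
  obtain N where N: "chain N v \<in> flag N" "\<And>i. i < N \<Longrightarrow> chain i v \<notin> flag i"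
    unfolding flag_def using sequence_dependent[of "\<lambda>i. chain i v"] by blast
  have "N > 0"
    using N(1) v by (cases N) (auto simp: flag_def)
  have succ: "chain (Suc i) v \<in> flag N" if "i < N" for i
    using that N(1) chain_in_flag[of "Suc i" N] by (cases "Suc i = N") auto
  have flag: "flag N = UNIV"
  proof (rule irreducible[OF subspace_flag])
    show a: "a x \<in> flag N" if "x \<in> flag N" for x
      using a.linear_axioms _ that by (rule flag_map) (intro a_chain_flag succ)
    show "b x \<in> flag N" if "x \<in> flag N" for x
      using flag_closed(2)[OF X_flag[OF that] a[OF that]] by simp
    show "c x \<in> flag N" if "x \<in> flag N" for x
      using c.linear_axioms _ that by (rule flag_map) (intro c_chain_flag succ, auto)
    show "flag N \<noteq> {0}"
      using chain_in_flag[OF \<open>N > 0\<close>] v by auto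
  qed
  have "independent ((\<lambda>i. chain i v) ` {..<N}) \<and> card ((\<lambda>i. chain i v) ` {..<N}) = N"
    by (rule independent_sequence) (use N(2) in \<open>simp add: flag_def\<close>)
  then have "dim (flag N) = N"
    unfolding flag_def by (simp add: dim_eq_card_independent)
  then have "N = dim UNIV" by (simp only: flag)
  then show "flag (dim UNIV) = UNIV" "\<And>i. i < dim UNIV \<Longrightarrow> chain i v \<notin> flag i"
    using flag N(2) by auto
qed

lemma dim_range_a: "(dim UNIV - 1) div 2 \<le> dim (range a)"
proof -
  let ?w = "\<lambda>i. chain i v" and ?n = "dim UNIV"
  \<comment> \<open>The positive even indices below the dimension, \<open>(?n - 1) div 2\<close> in
    number: exactly there \<open>chain\<close> was produced by an application of
    \<open>a\<close>.\<close>
  let ?I = "(\<lambda>j. 2 * j + 2) ` {..<(?n - 1) div 2}"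
  have ind: "independent (?w ` {..<?n}) \<and> card (?w ` {..<?n}) = ?n"
    by (rule independent_sequence) (use chain_basis(2) in \<open>simp add: flag_def\<close>)
  then have "inj_on ?w {..<?n}"
    by (intro eq_card_imp_inj_on) auto
  moreover have I: "?I \<subseteq> {..<?n}" by auto
  ultimately have "card (?w ` ?I) = card ?I"
    by (intro card_image) (rule inj_on_subset)
  also have "\<dots> = (?n - 1) div 2"
    by (subst card_image) (auto simp: inj_on_def)
  finally have "card (?w ` ?I) = (?n - 1) div 2" .
  moreover have "card (?w ` ?I) \<le> dim (range a)"
  proof (rule independent_card_le_dim)
    show "independent (?w ` ?I)"
      using ind I by (meson image_mono independent_mono)
    have "?w (2 * j + 2) \<in> range a" for j
      by simp
    then show "?w ` ?I \<subseteq> range a" by blast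
  qed
  ultimately show ?thesis by simp
qed

text \<open>The last index \<open>m\<close> is odd, and \<open>flag m\<close> is stable under
  \<open>a\<close> and \<open>b\<close>, of codimension one. On the quotient line \<open>a\<close>
  is nilpotent, hence zero, so \<open>b\<close> acts by the last weight,
  \<open>- \<beta> - dim UNIV\<close>. Its square must equal
  \<open>kb = \<beta> * \<beta>\<close>.\<close>

lemma even_dim_eigenvalue:
  assumes "even (dim UNIV)"
  shows "2 * \<beta> + of_nat (dim UNIV) = 0"
proof -
  let ?n = "dim (UNIV :: 'v set)"
  have "?n > 0" by (rule dim_UNIV_pos)
  then obtain m where m: "?n = Suc m" "odd m"
    using assms by (cases ?n) auto
  let ?w = "chain m v"
  have notin: "?w \<notin> flag m" and "flag (Suc m) = UNIV"
    using chain_basis m by auto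
  have coeff: "r = 0" if "scale r ?w \<in> flag m" for r
    using flag_closed(3)[OF that, of "inverse r"] notin by (cases "r = 0") auto
  have a_stable: "a x \<in> flag m" if "x \<in> flag m" for x
    using a.linear_axioms _ that
  proof (rule flag_map)
    fix i assume "i < m"
    show "a (chain i v) \<in> flag m"
    proof (cases "even i")
      case True
      then show ?thesis by (simp add: a_chain flag_closed)
    next
      case False
      \<comment> \<open>Distinct odd indices differ by at least two, so \<open>a\<close> never
        reaches the omitted vector \<open>chain m v\<close>.\<close>
      then have "Suc i < m" using \<open>i < m\<close> m(2) by (metis Suc_lessI even_Suc)
      then show ?thesis by (intro a_chain_flag chain_in_flag)
    qed
  qed
  have "a ?w \<in> flag (Suc m)"
    using \<open>flag (Suc m) = UNIV\<close> by simp
  then obtain r where r: "a ?w - scale r ?w \<in> flag m"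
    by (auto simp: flag_def lessThan_Suc span_breakdown_eq)
  define g where "g = a ?w - scale r ?w"
  have "a ?w = scale r ?w + g" by (simp add: g_def)
  \<comment> \<open>Modulo \<open>flag m\<close>, \<open>a\<close> multiplies \<open>?w\<close> by
    \<open>r\<close>; since \<open>a\<close> squares to zero, \<open>r * r = 0\<close>.\<close>
  then have "a (scale r ?w + g) = 0"
    using aa[of ?w] nilp by simp
  then have "scale (r * r) ?w = - (scale r g) - a g"
    using \<open>a ?w = scale r ?w + g\<close> by (simp add: a.add a.scale scale_right_distrib algebra_simps eq_neg_iff_add_eq_0)
  also have "\<dots> \<in> flag m"
    using r a_stable unfolding g_def[symmetric] by (intro flag_closed subspace_neg[OF subspace_flag]) auto
  finally have "r = 0" using coeff by fastforce
  then have aw: "a ?w \<in> flag m" using r by simp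
  define h where "h = (a ?w + b ?w - scale (weight \<beta> m) ?w) - a ?w"
  have h: "h \<in> flag m" "b ?w = scale (weight \<beta> m) ?w + h"
    unfolding h_def by (intro flag_closed(2) X_chain aw) simp
  have "b h \<in> flag m"
    using flag_closed(2)[OF X_flag[OF h(1)] a_stable[OF h(1)]] by simp
  have "scale kb ?w = scale (weight \<beta> m) (scale (weight \<beta> m) ?w + h) + b h"
    using bb[of ?w] unfolding h(2) by (simp add: b.add b.scale h(2))
  then have "scale (kb - weight \<beta> m * weight \<beta> m) ?w = scale (weight \<beta> m) h + b h"
    by (simp add: algebra_simps)
  also have "\<dots> \<in> flag m"
    using h \<open>b h \<in> flag m\<close> by (intro flag_closed)
  finally have "kb = weight \<beta> m * weight \<beta> m"
    using coeff by fastforce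
  moreover have "kb = \<beta> * \<beta>"
    using bb[of v] v by (simp add: b.scale)
  moreover have "weight \<beta> m = - (\<beta> + of_nat ?n)"
    using m by (simp add: weight_def)
  ultimately have "of_nat ?n * (2 * \<beta> + of_nat ?n) = 0"
    by (simp add: algebra_simps)
  then show ?thesis
    using \<open>?n > 0\<close> by simp
qed

end

text \<open>If \<open>v\<close> and \<open>v'\<close> were independent, then an eigenvector, for the eigenvalue \<open>l\<close>, of the linear map with
  \<open>chain i v \<mapsto> chain i v'\<close> would be a linear relation on the basis \<open>chain i (v' - l v)\<close>.\<close>

lemma joint_eigenvector_unique:
  assumes nilp: "ka = 0"
    and v: "v \<noteq> 0" "a v = 0" "b v = scale \<beta> v" and v': "a v' = 0" "b v' = scale \<beta> v'"
  shows "\<exists>r. v' = scale r v"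
proof (rule ccontr)
  assume contr: "\<not> ?thesis"
  let ?n = "dim (UNIV :: 'v set)"
  let ?I = "{..<?n}"
  define w where "w i = chain i v" for i
  have not_span: "chain i u \<notin> span ((\<lambda>i. chain i u) ` {..<i})"
    if "u \<noteq> 0" "a u = 0" "b u = scale \<beta> u" "i < ?n" for u i
    using chain_basis(2)[OF nilp that(1-3,4)] by (simp add: flag_def[OF nilp that(1-3)])
  have w: "w i \<notin> span (w ` {..<i})" if "i < ?n" for i
    using not_span[OF v that] by (simp add: w_def[abs_def])
  have spanw: "span (w ` ?I) = UNIV"
    using chain_basis(1)[OF nilp v] by (simp add: flag_def[OF nilp v] w_def[abs_def])
  have ind: "independent (w ` ?I) \<and> card (w ` ?I) = ?n"
    by (rule independent_sequence) (rule w)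
  then have inj: "inj_on w ?I"
    by (intro eq_card_imp_inj_on) auto
  interpret pair: vector_space_pair scale scale ..
  obtain T where T: "Vector_Spaces.linear scale scale T"
      "\<And>x. x \<in> w ` ?I \<Longrightarrow> T x = chain (the_inv_into ?I w x) v'"
    using pair.linear_independent_extend[of "w ` ?I" "\<lambda>x. chain (the_inv_into ?I w x) v'"] ind by blast
  have Tw: "T (w i) = chain i v'" if "i < ?n" for i
    using T(2)[of "w i"] that inj by (simp add: the_inv_into_f_f)
  have "(UNIV :: 'v set) \<noteq> {0}"
    using nontrivial by blast
  then obtain y l where y: "y \<noteq> 0" "T y = scale l y"
    by (rule eigenvector_exists[OF finite_dimensional_vector_space_axioms T(1) subspace_UNIV]) auto
  obtain r where r: "y = (\<Sum>i<?n. scale (r i) (w i))"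
    using span_sequence[of y w ?n] spanw by auto
  interpret T: Vector_Spaces.linear scale scale T by (rule T)
  have "(\<Sum>i<?n. scale (r i) (chain i (v' - scale l v))) = T y - scale l y"
  proof -
    have "T y = (\<Sum>i<?n. scale (r i) (chain i v'))"
      unfolding r T.sum T.scale by (intro sum.cong) (simp_all add: Tw)
    then show ?thesis
      by (simp add: r chain_lin w_def scale_right_diff_distrib sum_subtractf scale_sum_right mult.commute)
  qed
  then have sum0: "(\<Sum>i<?n. scale (r i) (chain i (v' - scale l v))) = 0"
    using y by simp
  have u: "v' - scale l v \<noteq> 0" "a (v' - scale l v) = 0" "b (v' - scale l v) = scale \<beta> (v' - scale l v)"
    using contr v v' by (auto simp: a.diff a.scale b.diff b.scale scale_right_diff_distrib mult.commute)
  have "r i = 0" if "i < ?n" for i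
    by (rule sequence_independentD[OF _ sum0 that]) (rule not_span[OF u])
  then have "y = 0" unfolding r by simp
  then show False using y by simp
qed

section \<open>Rank versus nullity of \<open>a\<close>\<close>

lemma range_a_subset_kernel: "ka = 0 \<Longrightarrow> range a \<subseteq> {x. a x = 0}"
  by (auto simp: aa)

lemma rank_nullity_a: "dim UNIV = dim (range a) + dim {x. a x = 0}"
  using rank_nullity[OF a.linear_axioms subspace_UNIV] by simp

lemma dim_kernel_le:
  assumes nilp: "ka = 0"
  shows "dim {x. a x = 0} \<le> dim (range a) + 1"
proof (rule ccontr)
  let ?n = "dim (UNIV :: 'v set)" and ?K = "{x. a x = 0}"
  assume contr: "\<not> ?thesis"
  \<comment> \<open>\<open>E\<close> is the kernel of \<open>a\<close> after \<open>b\<close> on the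
    kernel of \<open>a\<close>. The rank of this map is at most that of \<open>a\<close>, so a
    nullity of \<open>a\<close> exceeding its rank by two leaves dimension at least two for
    \<open>E\<close>.\<close>
  define E where "E = {x. a x = 0 \<and> a (b x) = 0}"
  have linear: "Vector_Spaces.linear scale scale (\<lambda>x. a (b x))"
    by unfold_locales (simp_all add: a.add b.add a.scale b.scale)
  have "dim ?K = dim ((\<lambda>x. a (b x)) ` ?K) + dim E"
    using rank_nullity[OF linear a.subspace_kernel] by (simp add: E_def)
  moreover have "dim ((\<lambda>x. a (b x)) ` ?K) \<le> dim (range a)"
    by (rule dim_subset) auto
  ultimately have dimE: "dim E \<ge> 2"
    using contr by linarith
  have E: "subspace E"
    by (auto simp: E_def subspace_def a.add b.add a.scale b.scale)
  have bE: "b x \<in> E" if "x \<in> E" for x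
    using that by (simp add: E_def bb a.scale)
  have "E \<noteq> {0}"
    using dimE by (metis dim_singleton not_numeral_le_zero)
  then obtain v \<beta> where v: "v \<in> E" "v \<noteq> 0" "b v = scale \<beta> v"
    using eigenvector_exists[OF finite_dimensional_vector_space_axioms b.linear_axioms E] bE by metis
  have av: "a v = 0" using v by (simp add: E_def)
  show False
  proof (cases "even ?n")
    case False
    \<comment> \<open>One vector \<open>v\<close> suffices here: rank at least \<open>m\<close> out
      of \<open>2 * m + 1\<close> leaves nullity at most \<open>m + 1\<close>.\<close>
    then obtain m where "?n = 2 * m + 1" by (rule oddE)
    then show False
      using dim_range_a[OF nilp v(2) av v(3)] rank_nullity_a contr by simp
  next
    case True
    have "x \<in> span {v}" if x: "x \<in> E" for x
    proof -
      \<comment> \<open>\<open>b\<close> squares to \<open>\<beta> * \<beta>\<close>, so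
        \<open>y\<close> is zero or an eigenvector for \<open>- \<beta>\<close>. In the latter case
        \<open>even_dim_eigenvalue\<close> for both signs would make the dimension zero. So
        \<open>x\<close> is a \<open>\<beta>\<close>-eigenvector and
        \<open>joint_eigenvector_unique\<close> applies.\<close>
      define y where "y = b x - scale \<beta> x"
      have y: "y \<in> E"
        unfolding y_def using x E bE by (intro subspace_diff subspace_scale)
      have "kb = \<beta> * \<beta>"
        using bb[of v] v by (simp add: b.scale)
      then have "b y = scale (- \<beta>) y"
        by (simp add: y_def b.diff b.scale bb scale_right_diff_distrib)
      have "y = 0"
      proof (rule ccontr)
        assume "y \<noteq> 0"
        then have "2 * (- \<beta>) + of_nat ?n = 0"
          using y \<open>b y = _\<close> True by (intro even_dim_eigenvalue[OF nilp]) (auto simp: E_def)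
        moreover have "2 * \<beta> + of_nat ?n = 0"
          by (rule even_dim_eigenvalue[OF nilp v(2) av v(3) True])
        ultimately have "of_nat (2 * ?n) = (0 :: 'f)"
          unfolding of_nat_mult by (simp add: algebra_simps eq_neg_iff_add_eq_0 add_eq_0_iff)
        then have "?n = 0" by (simp only: of_nat_eq_0_iff)
        then show False using dim_UNIV_pos by simp
      qed
      then show ?thesis
        using joint_eigenvector_unique[OF nilp v(2) av v(3), of x] x
        by (auto simp: y_def E_def span_singleton)
    qed
    then have "dim E \<le> card {v}"
      by (intro dim_le_card) auto
    then show False using dimE by simp
  qed
qed


lemma double: "scale 2 x = x + x"
  by (metis one_add_one scale_left_distrib scale_one)

subsection \<open>Classification of the stable subspaces\<close>

lemma racah_stable_zero: "racah_stable {0}" and racah_stable_UNIV: "racah_stable UNIV"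
  using ab_lin(3)[of 0 0] ab_lin(6)[of 0 0] by (auto simp: racah_stable_def)

lemma racah_stable_eigenspace: "racah_stable {x. a x = scale \<theta> x}"
  by (auto simp: racah_stable_def subspace_def a.add a.scale scale_right_distrib mult.commute
      ab_lin simp flip: ab_a ac_a)

lemma racah_stable_image: "racah_stable W \<Longrightarrow> racah_stable (a ` W)"
  unfolding racah_stable_def by (auto simp: a.subspace_image ab_a ac_a)

lemma racah_stable_Int: "racah_stable V \<Longrightarrow> racah_stable W \<Longrightarrow> racah_stable (V \<inter> W)"
  unfolding racah_stable_def by (auto intro: subspace_inter)

section \<open>The nilpotent case\<close>

lemma racah_stable_between:
  assumes "subspace W" "range a \<subseteq> W" "W \<subseteq> {x. a x = 0}"
  shows "racah_stable W"
proof -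
  have "a x = 0" if "x \<in> W" for x using assms that by blast
  \<comment> \<open>On the kernel of \<open>a\<close>, \<open>ab x = a (b x)\<close> and
    \<open>ac x = a (c x)\<close>, so both land in the image of \<open>a\<close>.\<close>
  then show ?thesis
    using assms subspace_0 by (auto simp: racah_stable_def ab_def ac_def)
qed

text \<open>Inside the kernel of \<open>a\<close> this is \<open>racah_stable_absorbs\<close> at
  \<open>\<theta> = 0\<close>. Otherwise the image of \<open>W\<close> under \<open>a\<close> is a
  nonzero stable subspace of the kernel contained in \<open>W\<close>.\<close>

lemma range_a_subset_racah_stable:
  assumes nilp: "ka = 0" and W: "racah_stable W" "W \<noteq> {0}"
  shows "range a \<subseteq> W"
proof -
  have *: "range a \<subseteq> U" if U: "racah_stable U" "U \<noteq> {0}" "U \<subseteq> {x. a x = 0}" for U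
    using racah_stable_absorbs[OF U(1,2), of 0] U(3) nilp by auto
  show ?thesis
  proof (cases "W \<subseteq> {x. a x = 0}")
    case True
    then show ?thesis using * W by blast
  next
    case False
    then have "a ` W \<noteq> {0}" by blast
    then have "range a \<subseteq> a ` W"
      using range_a_subset_kernel[OF nilp] by (intro * racah_stable_image W) auto
    also have "a ` W \<subseteq> W"
      using racah_stableD(2)[OF W(1)] by auto
    finally show ?thesis .
  qed
qed

lemma racah_stable_nilpotent_iff:
  assumes nilp: "ka = 0"
  shows "racah_stable W \<longleftrightarrow>
    W = {0} \<or> W = UNIV \<or> subspace W \<and> range a \<subseteq> W \<and> W \<subseteq> {x. a x = 0}"
proof
  assume W: "racah_stable W"
  then show "W = {0} \<or> W = UNIV \<or> subspace W \<and> range a \<subseteq> W \<and> W \<subseteq> {x. a x = 0}"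
    using range_a_subset_racah_stable[OF nilp W] racah_stable_subset_kernel[OF nilp W]
      racah_stableD(1)[OF W] by blast
next
  assume "W = {0} \<or> W = UNIV \<or> subspace W \<and> range a \<subseteq> W \<and> W \<subseteq> {x. a x = 0}"
  then show "racah_stable W"
    using racah_stable_zero racah_stable_UNIV racah_stable_between by blast
qed

lemma dim_range_a_le: "ka = 0 \<Longrightarrow> dim (range a) \<le> dim {x. a x = 0}"
  by (intro dim_subset range_a_subset_kernel)

text \<open>Rank \<open>r\<close> and nullity \<open>k\<close> satisfy
  \<open>r \<le> k \<le> r + 1\<close> and add up to the dimension. Even parity forces
  \<open>r = k\<close>, so image and kernel of \<open>a\<close> coincide.\<close>

lemma nilpotent_even:
  assumes nilp: "ka = 0" and nz: "a x0 \<noteq> 0" and even: "even (dim (UNIV :: 'v set))"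
  shows "Collect racah_stable = {{0}, {x. a x = 0}, UNIV}" "{0} \<subset> {x. a x = 0}" "{x. a x = 0} \<subset> UNIV"
proof -
  have parity: "r = k" if "n = r + k" "k \<le> r + 1" "r \<le> k" "even n" for n r k :: nat
  proof -
    have "k = r \<or> k = r + 1"
      using that(2,3) by linarith
    then show ?thesis
      using that(1,4) by auto
  qed
  have "dim (range a) = dim {x. a x = 0}"
    by (rule parity[OF rank_nullity_a dim_kernel_le[OF nilp] dim_range_a_le[OF nilp] even])
  then have eq: "range a = {x. a x = 0}"
    using subspace_dim_equal[OF a.subspace_image[OF subspace_UNIV] a.subspace_kernel range_a_subset_kernel[OF nilp]]
    by simp
  show "Collect racah_stable = {{0}, {x. a x = 0}, UNIV}"
    using racah_stable_nilpotent_iff[OF nilp] a.subspace_kernel unfolding eq by auto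
  have "a x0 \<in> {x. a x = 0}" using eq by blast
  then show "{0} \<subset> {x. a x = 0}" using nz by auto
  show "{x. a x = 0} \<subset> UNIV" using nz by auto
qed

text \<open>Odd parity makes the image of codimension one in the kernel, with no room in between.
  The image of \<open>a\<close> is the submodule called V(0)' in the theorem.\<close>

lemma nilpotent_odd:
  assumes nilp: "ka = 0" and nz: "a x0 \<noteq> 0" and odd: "odd (dim (UNIV :: 'v set))"
  shows "Collect racah_stable = {{0}, range a, {x. a x = 0}, UNIV}" "{0} \<subset> range a"
    "range a \<subset> {x. a x = 0}" "{x. a x = 0} \<subset> UNIV" "dim {x. a x = 0} = dim (range a) + 1"
proof -
  have parity: "k = r + 1" if "n = r + k" "k \<le> r + 1" "r \<le> k" "odd n" for n r k :: nat
  proof -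
    have "k = r \<or> k = r + 1"
      using that(2,3) by linarith
    then show ?thesis
      using that(1,4) by auto
  qed
  show dims: "dim {x. a x = 0} = dim (range a) + 1"
    by (rule parity[OF rank_nullity_a dim_kernel_le[OF nilp] dim_range_a_le[OF nilp] odd])
  have sub: "subspace (range a)" "range a \<subseteq> {x. a x = 0}"
    using a.subspace_image[OF subspace_UNIV] range_a_subset_kernel[OF nilp] by auto
  have "W = range a \<or> W = {x. a x = 0}"
    if W: "subspace W" "range a \<subseteq> W" "W \<subseteq> {x. a x = 0}" for W
  proof -
    have "dim (range a) \<le> dim W" "dim W \<le> dim {x. a x = 0}"
      using W by (auto intro: dim_subset)
    then have "dim W \<le> dim (range a) \<or> dim {x. a x = 0} \<le> dim W"
      using dims by linarith
    then show ?thesis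
      using subspace_dim_equal[OF sub(1) W(1,2)] subspace_dim_equal[OF W(1) a.subspace_kernel W(3)] by blast
  qed
  then show "Collect racah_stable = {{0}, range a, {x. a x = 0}, UNIV}"
    using racah_stable_nilpotent_iff[OF nilp] a.subspace_kernel sub by blast
  show "{0} \<subset> range a"
    using nz sub(1) subspace_0 by blast
  show "range a \<subset> {x. a x = 0}"
    using sub(2) dims by auto
  show "{x. a x = 0} \<subset> UNIV" using nz by auto
qed

section \<open>The case of scalar \<open>a\<close>\<close>

lemma scalar_racah_stable:
  assumes a: "\<And>x. a x = scale \<theta> x" and W: "racah_stable W" "W \<noteq> {0}"
  shows "W = UNIV"
proof -
  have ka: "ka = \<theta> * \<theta>"
    using aa nontrivial by (auto simp: a)
  show ?thesis
  proof (cases "\<theta> = 0")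
    case False
    \<comment> \<open>\<open>a + \<theta>\<close> is now \<open>2 * \<theta>\<close>, so absorption
      already puts every vector into \<open>W\<close>.\<close>
    have "scale (1 / (2 * \<theta>)) (a v + scale \<theta> v) \<in> W" for v
      by (intro subspace_scale racah_stableD(1)[OF W(1)] racah_stable_absorbs[OF W a ka])
    moreover have "scale (1 / (2 * \<theta>)) (a v + scale \<theta> v) = v" for v
      using False by (simp add: a flip: scale_left_distrib)
    ultimately show ?thesis by auto
  next
    case True
    have cb: "c (b x) = scale (kd - 1 - ka - kb - kc) x - b x - b x - c x - c x - b (c x)" for x
      using c_b[of x] by (simp add: a True ab_def ac_def)
    \<comment> \<open>With \<open>a = 0\<close> the product \<open>b c b\<close> is computed twice
      from \<open>cb\<close>: at \<open>b x\<close>, and by applying \<open>b\<close>. Hence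
      \<open>b\<close> and \<open>c\<close> commute, Schur's lemma makes them scalars, and every
      subspace is stable.\<close>
    have "c (b x) + c (b x) = b (c x) + b (c x)" for x
    proof -
      have "b (c (b x)) + scale kb (c x)
          = scale (kd - 1 - ka - kb - kc) (b x) - b (b x) - b (b x) - c (b x) - c (b x)"
        using cb[of "b x"] by (simp add: bb c.scale algebra_simps)
      moreover have "b (c (b x)) + scale kb (c x)
          = scale (kd - 1 - ka - kb - kc) (b x) - b (b x) - b (b x) - b (c x) - b (c x)"
        unfolding cb[of x] b.diff b.scale by (simp add: bb)
      ultimately show ?thesis by (simp add: algebra_simps)
    qed
    then have bc: "c (b x) = b (c x)" for x
      by (metis double scale_cancel_left zero_neq_numeral)
    have irred: "W = UNIV"
      if "subspace W" "\<And>S x. \<lbrakk>S \<in> {a, b, c}; x \<in> W\<rbrakk> \<Longrightarrow> S x \<in> W" "W \<noteq> {0}" for W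
      by (rule irreducible[OF that(1) _ _ _ that(3)]) (simp_all add: that(2))
    have lin: "S (scale r x) = scale r (S x)" if "S \<in> {a, b, c}" for S r x
      using that by (auto simp: a.scale b.scale c.scale)
    have comm: "b (S x) = S (b x)" "c (S x) = S (c x)" if "S \<in> {a, b, c}" for S x
      using that by (auto simp: a b.scale c.scale bc)
    note scalar = commuting_operator_scalar[where Ts = "{a, b, c}",
        OF finite_dimensional_vector_space_axioms nontrivial irred _ _ lin]
    obtain \<beta> where \<beta>: "\<And>x. b x = scale \<beta> x"
      using scalar[OF _ _ _ b.linear_axioms comm(1)] by blast
    obtain \<gamma> where \<gamma>: "\<And>x. c x = scale \<gamma> x"
      using scalar[OF _ _ _ c.linear_axioms comm(2)] by blast
    note W' = racah_stableD(1)[OF W(1)]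
    show ?thesis
      by (rule irreducible[OF W' _ _ _ W(2)]) (simp_all add: a \<beta> \<gamma> subspace_scale[OF W'])
  qed
qed

text \<open>For an eigenvector \<open>v\<close> of \<open>b\<close>, \<open>c_b\<close> expresses
  \<open>b (c v)\<close> by \<open>v\<close> and \<open>c v\<close>, so these two span a stable
  subspace.\<close>

lemma scalar_dim_le:
  assumes a: "\<And>x. a x = scale \<theta> x"
  shows "dim (UNIV :: 'v set) \<le> 2"
proof -
  have "(UNIV :: 'v set) \<noteq> {0}"
    using nontrivial by blast
  then obtain v \<beta> where v: "v \<noteq> 0" "b v = scale \<beta> v"
    by (rule eigenvector_exists[OF finite_dimensional_vector_space_axioms b.linear_axioms subspace_UNIV]) auto
  let ?S = "{v, c v}"
  have mem: "v \<in> span ?S" "c v \<in> span ?S"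
    by (auto intro: span_base)
  note closed = span_add span_diff span_scale mem
  have "c (b v) = scale \<beta> (c v)"
    by (simp add: v c.scale)
  then have "b (c v) = scale (kd - 1 - ka - kb - kc) v - a v - a v - b v - b v - c v - c v
      - ab v - ac v - scale \<beta> (c v)"
    using c_b[of v] by (simp add: algebra_simps)
  then have bc: "b (c v) \<in> span ?S"
    by (simp add: a ab_def ac_def b.scale c.scale v closed)
  have "span ?S = UNIV"
  proof (rule irreducible)
    show "a x \<in> span ?S" if "x \<in> span ?S" for x
      using that by (simp add: a span_scale)
    show "b x \<in> span ?S" if "x \<in> span ?S" for x
      using b.linear_axioms _ that by (rule span_stable) (use v bc in \<open>auto simp: closed\<close>)
    show "c x \<in> span ?S" if "x \<in> span ?S" for x
      using c.linear_axioms _ that by (rule span_stable) (auto simp: cc closed)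
    show "span ?S \<noteq> {0}"
      using v mem by blast
  qed simp
  then have "dim (UNIV :: 'v set) \<le> card ?S"
    by (intro dim_le_card) auto
  also have "\<dots> \<le> 2"
    by (cases "c v = v") auto
  finally show ?thesis .
qed

section \<open>Two eigenvalues of opposite sign\<close>

lemma eigenspace_subset_racah_stable:
  assumes "\<theta> \<noteq> 0" "ka = \<theta> * \<theta>" and W: "racah_stable W" and x: "x \<in> W" "x \<noteq> 0" "a x = scale \<theta> x"
  shows "{y. a y = scale \<theta> y} \<subseteq> W"
proof
  fix y assume y: "y \<in> {y. a y = scale \<theta> y}"
  let ?W = "W \<inter> {x. a x = scale \<theta> x}"
  \<comment> \<open>Absorption is applied to the nonzero stable subspace \<open>?W\<close> of the
    eigenspace; on \<open>y\<close> itself \<open>a + \<theta>\<close> is multiplication by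
    \<open>2 * \<theta>\<close>.\<close>
  have "a y + scale \<theta> y \<in> ?W"
    using x assms(2) by (intro racah_stable_absorbs racah_stable_Int racah_stable_eigenspace W) auto
  then have "scale (1 / (2 * \<theta>)) (a y + scale \<theta> y) \<in> W"
    using racah_stableD(1)[OF W] by (blast intro: subspace_scale)
  then show "y \<in> W"
    using y \<open>\<theta> \<noteq> 0\<close> by (simp flip: scale_left_distrib)
qed

text \<open>Up to scalar factors \<open>a + \<theta>\<close> and \<open>a - \<theta>\<close> are the
  projections to the two eigenspaces. With \<open>y\<close> and \<open>z\<close> unnormalized it is
  plain that they lie in every \<open>a\<close>-stable subspace containing \<open>x\<close>.\<close>

lemma eigen_decomposition:
  assumes "\<theta> \<noteq> 0" "ka = \<theta> * \<theta>"
  obtains y z where "x = scale (1 / (2 * \<theta>)) y - scale (1 / (2 * \<theta>)) z"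
    "y = a x + scale \<theta> x" "z = a x - scale \<theta> x" "a y = scale \<theta> y" "a z = scale (- \<theta>) z"
proof
  show "x = scale (1 / (2 * \<theta>)) (a x + scale \<theta> x) - scale (1 / (2 * \<theta>)) (a x - scale \<theta> x)"
    using assms(1) by (simp add: scale_right_distrib scale_right_diff_distrib flip: scale_left_distrib)
qed (use assms in \<open>simp_all add: a.add a.diff a.scale aa algebra_simps\<close>)

text \<open>A stable \<open>W\<close> is the sum of its intersections with the two eigenspaces, and
  each intersection is zero or the full eigenspace. The four combinations give the four
  subspaces.\<close>

lemma two_eigenvalues:
  assumes \<theta>: "\<theta> \<noteq> 0" "ka = \<theta> * \<theta>"
    and u: "u \<noteq> 0" "a u = scale \<theta> u" and w: "w \<noteq> 0" "a w = scale (- \<theta>) w"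
  defines "V \<equiv> \<lambda>\<theta>. {x. a x = scale \<theta> x}"
  shows "Collect racah_stable = {{0}, V (- \<theta>), V \<theta>, UNIV}"
    "distinct [{0}, V (- \<theta>), V \<theta>, UNIV]" "\<not> V (- \<theta>) \<subseteq> V \<theta>" "\<not> V \<theta> \<subseteq> V (- \<theta>)"
proof -
  have neg: "- \<theta> \<noteq> 0" "ka = - \<theta> * - \<theta>" using \<theta> by auto
  have "\<theta> \<noteq> - \<theta>" using \<theta>(1) by (simp add: eq_neg_iff_add_eq_0 flip: mult_2)
  then have notin: "w \<notin> V \<theta>" "u \<notin> V (- \<theta>)"
    using u w by (auto simp: V_def simp del: scale_minus_left)
  moreover have "w \<in> V (- \<theta>)" "u \<in> V \<theta>"
    using u w by (auto simp: V_def)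
  ultimately show "\<not> V (- \<theta>) \<subseteq> V \<theta>" "\<not> V \<theta> \<subseteq> V (- \<theta>)"
    by blast+
  then show "distinct [{0}, V (- \<theta>), V \<theta>, UNIV]"
    using \<open>w \<in> V (- \<theta>)\<close> \<open>u \<in> V \<theta>\<close> u w notin by auto
  have "W \<in> {{0}, V (- \<theta>), V \<theta>, UNIV}" if W: "racah_stable W" for W
  proof -
    note W' = racah_stableD[OF W]
    have dec: "\<exists>y z. x = scale (1 / (2 * \<theta>)) y - scale (1 / (2 * \<theta>)) z \<and> y \<in> W \<inter> V \<theta> \<and> z \<in> W \<inter> V (- \<theta>)"
      if "x \<in> W" for x
    proof -
      obtain y z where yz: "x = scale (1 / (2 * \<theta>)) y - scale (1 / (2 * \<theta>)) z"
        "y = a x + scale \<theta> x" "z = a x - scale \<theta> x" "a y = scale \<theta> y" "a z = scale (- \<theta>) z"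
        by (rule eigen_decomposition[OF \<theta>])
      then have "y \<in> W" "z \<in> W"
        using that W' by (auto intro: subspace_add subspace_diff subspace_scale)
      then show ?thesis
        using yz unfolding V_def by blast
    qed
    have pos: "V \<theta> \<subseteq> W" if "\<not> W \<inter> V \<theta> \<subseteq> {0}"
      using that eigenspace_subset_racah_stable[OF \<theta> W] by (auto simp: V_def)
    have neg': "V (- \<theta>) \<subseteq> W" if "\<not> W \<inter> V (- \<theta>) \<subseteq> {0}"
      using that eigenspace_subset_racah_stable[OF neg W] unfolding V_def by blast
    have sub: "subspace (V r)" for r
      using racah_stableD(1)[OF racah_stable_eigenspace] by (simp add: V_def)
    have "W = {0}" if "W \<inter> V \<theta> \<subseteq> {0}" "W \<inter> V (- \<theta>) \<subseteq> {0}"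
      using dec that subspace_0[OF W'(1)] by fastforce
    moreover have "W = V \<theta>" if VW: "V \<theta> \<subseteq> W" "W \<inter> V (- \<theta>) \<subseteq> {0}"
    proof
      show "W \<subseteq> V \<theta>"
      proof
        fix x assume "x \<in> W"
        then obtain y z where "x = scale (1 / (2 * \<theta>)) y - scale (1 / (2 * \<theta>)) z" "y \<in> V \<theta>" "z = 0"
          using dec VW(2) by blast
        then show "x \<in> V \<theta>" using sub by (auto intro: subspace_scale)
      qed
    qed (rule VW)
    moreover have "W = V (- \<theta>)" if VW: "V (- \<theta>) \<subseteq> W" "W \<inter> V \<theta> \<subseteq> {0}"
    proof
      show "W \<subseteq> V (- \<theta>)"
      proof
        fix x assume "x \<in> W"
        then obtain y z where "x = scale (1 / (2 * \<theta>)) y - scale (1 / (2 * \<theta>)) z" "z \<in> V (- \<theta>)" "y = 0"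
          using dec VW(2) by blast
        then show "x \<in> V (- \<theta>)" using sub by (auto intro: subspace_scale subspace_neg)
      qed
    qed (rule VW)
    moreover have "W = UNIV" if VW: "V \<theta> \<subseteq> W" "V (- \<theta>) \<subseteq> W"
    proof -
      have "x \<in> W" for x
      proof -
        obtain y z where yz: "x = scale (1 / (2 * \<theta>)) y - scale (1 / (2 * \<theta>)) z"
          "y = a x + scale \<theta> x" "z = a x - scale \<theta> x" "a y = scale \<theta> y" "a z = scale (- \<theta>) z"
          by (rule eigen_decomposition[OF \<theta>])
        then have "y \<in> W" "z \<in> W"
          using VW unfolding V_def by blast+
        then show ?thesis
          unfolding yz(1) using W'(1) by (intro subspace_diff subspace_scale)
      qed
      then show ?thesis by blast
    qed
    ultimately show ?thesis
      using pos neg' by blast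
  qed
  moreover have "racah_stable W" if "W \<in> {{0}, V (- \<theta>), V \<theta>, UNIV}" for W
    using that racah_stable_zero racah_stable_UNIV racah_stable_eigenspace unfolding V_def by blast
  ultimately show "Collect racah_stable = {{0}, V (- \<theta>), V \<theta>, UNIV}"
    by blast
qed

section \<open>Diagonalizability and eigenvalues of \<open>a\<close>\<close>

lemma diagonalizable_if_ka_nonzero:
  assumes "ka \<noteq> 0"
  shows "op_diagonalizable scale a"
proof -
  obtain \<theta> where "\<theta> ^ 2 = ka"
    using nth_root_exists[of 2 ka] by auto
  then have \<theta>: "\<theta> \<noteq> 0" "ka = \<theta> * \<theta>"
    using assms by (auto simp: power2_eq_square)
  let ?S = "{x. a x = scale \<theta> x} \<union> {x. a x = scale (- \<theta>) x}"
  obtain E where E: "E \<subseteq> ?S" "independent E" "?S \<subseteq> span E"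
    using maximal_independent_subset[of ?S] by metis
  have "x \<in> span E" for x
  proof -
    obtain y z where yz: "x = scale (1 / (2 * \<theta>)) y - scale (1 / (2 * \<theta>)) z"
      "y = a x + scale \<theta> x" "z = a x - scale \<theta> x" "a y = scale \<theta> y" "a z = scale (- \<theta>) z"
      by (rule eigen_decomposition[OF \<theta>])
    then have "y \<in> span E" "z \<in> span E"
      using E(3) by blast+
    then show ?thesis
      unfolding yz(1) by (intro span_diff span_scale)
  qed
  then show ?thesis
    unfolding op_diagonalizable_def using E(1,2) by blast
qed

lemma not_diagonalizable:
  assumes "\<not> op_diagonalizable scale a"
  shows "ka = 0" "\<exists>x. a x \<noteq> 0"
proof -
  show "ka = 0"
    using assms diagonalizable_if_ka_nonzero by blast
  show "\<exists>x. a x \<noteq> 0"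
  proof (rule ccontr)
    assume "\<not> ?thesis"
    then have "a x = scale 0 x" for x by simp
    then have "op_diagonalizable scale a"
      unfolding op_diagonalizable_def using independent_Basis span_Basis by metis
    then show False using assms by blast
  qed
qed

lemma eigenvalue_square: "\<theta> \<in> op_eigenvalues scale a \<Longrightarrow> \<theta> * \<theta> = ka"
proof -
  assume "\<theta> \<in> op_eigenvalues scale a"
  then obtain v where v: "v \<noteq> 0" "a v = scale \<theta> v" by (auto simp: op_eigenvalues_def)
  then show "\<theta> * \<theta> = ka" using aa[of v] by (auto simp: a.scale)
qed

lemma eigenvalues_subset:
  assumes "\<theta> \<in> op_eigenvalues scale a"
  shows "op_eigenvalues scale a \<subseteq> {\<theta>, - \<theta>}"
proof
  fix l assume "l \<in> op_eigenvalues scale a"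
  then have "l * l = \<theta> * \<theta>"
    using eigenvalue_square assms by metis
  then show "l \<in> {\<theta>, - \<theta>}"
    by (simp add: square_eq_iff)
qed

lemma scalar_if_one_eigenvalue:
  assumes "op_diagonalizable scale a" "op_eigenvalues scale a = {\<theta>}"
  shows "a x = scale \<theta> x"
proof -
  obtain E where E: "independent E" "span E = UNIV" "\<And>e. e \<in> E \<Longrightarrow> \<exists>\<theta>. a e = scale \<theta> e"
    using assms(1) by (auto simp: op_diagonalizable_def)
  have "E \<subseteq> {x. a x = scale \<theta> x}"
  proof
    fix e assume e: "e \<in> E"
    then obtain l where "a e = scale l e" using E(3) by blast
    moreover have "e \<noteq> 0" using e E(1) dependent_zero by blast
    ultimately have "l \<in> op_eigenvalues scale a" by (auto simp: op_eigenvalues_def)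
    then show "e \<in> {x. a x = scale \<theta> x}" using assms(2) \<open>a e = _\<close> by simp
  qed
  then have "span E \<subseteq> {x. a x = scale \<theta> x}"
    using racah_stableD(1)[OF racah_stable_eigenspace] by (rule span_minimal)
  then show ?thesis using E(2) by blast
qed


section \<open>The images of the Racah generators, and the submodule lattice\<close>

lemma racah_quadratic_AB:
  "d (d x + c x + (x + x)) + c (d x + c x + (x + x)) = ab x + scale (ka + kb - 1) x"
  "b (b x + d x + (x + x)) + d (b x + d x + (x + x)) = ac x + scale (ka + kc - 1) x"
  \<comment> \<open>With \<open>u = a + b\<close> one has \<open>d + c = - (1 + u)\<close>, so
    \<open>(d + c) (d + c + 2)\<close> is the square of \<open>u\<close> minus one; likewise for
    \<open>b + d\<close> and \<open>u = a + c\<close>.\<close>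
  unfolding d_eq
  by (simp_all add: a.add b.add c.add a.diff b.diff c.diff a.neg b.neg c.neg aa bb cc ab_def ac_def algebra_simps)

text \<open>This makes \<open>a\<close> visible to the Racah algebra: together with the two
  expressions of \<open>racah_quadratic_AB\<close> it adds up to a scalar minus
  \<open>2 a\<close>.\<close>

lemma racah_quadratic_C:
  "c (c x + b x + (x + x)) + b (c x + b x + (x + x)) = scale (kd - 1 - ka) x - a x - a x - ab x - ac x"
  using c_b[of x] by (simp add: b.add c.add bb cc algebra_simps)

text \<open>The acting algebra enters only through its lattice of submodules, hence the arbitrary
  map \<open>ract\<close>.\<close>

lemma submodule_lattice:
  fixes ract :: "'r \<Rightarrow> 'v \<Rightarrow> 'v"
  assumes ract: "alg_submodules scale ract = Collect racah_stable"
  shows "(let V = op_eigenspace scale a;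
          eigs = op_eigenvalues scale a;
          dimV = dim;
          subs = alg_submodules scale ract
      in
        (\<not> op_diagonalizable scale a \<longrightarrow>
           eigs = {0} \<and>
           (even (dimV UNIV) \<longrightarrow>
              subs = {{0}, V 0, UNIV} \<and> {0} \<subset> V 0 \<and> V 0 \<subset> UNIV) \<and>
           (odd (dimV UNIV) \<longrightarrow>
              (\<exists>!V'. irreducible_on scale ract V' \<and> V' \<subseteq> V 0 \<and> dimV (V 0) = dimV V' + 1) \<and>
              (\<forall>V'. irreducible_on scale ract V' \<and> V' \<subseteq> V 0 \<and> dimV (V 0) = dimV V' + 1 \<longrightarrow>
                 subs = {{0}, V', V 0, UNIV} \<and>
                 {0} \<subset> V' \<and> V' \<subset> V 0 \<and> V 0 \<subset> UNIV)))
        \<and>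
        (op_diagonalizable scale a \<longrightarrow>
           finite eigs \<and> card eigs \<le> 2 \<and>
           (card eigs = 1 \<longrightarrow>
              irreducible_on scale ract UNIV \<and> dimV UNIV \<le> 2) \<and>
           (card eigs = 2 \<longrightarrow>
              (\<exists>\<theta>. \<theta> \<noteq> 0 \<and> eigs = {\<theta>, - \<theta>} \<and>
                 subs = {{0}, V (- \<theta>), V \<theta>, UNIV} \<and>
                 distinct [{0}, V (- \<theta>), V \<theta>, UNIV] \<and>
                 \<not> V (- \<theta>) \<subseteq> V \<theta> \<and> \<not> V \<theta> \<subseteq> V (- \<theta>)))))"
proof -
  let ?V = "op_eigenspace scale a" and ?eigs = "op_eigenvalues scale a"
  have V0: "?V 0 = {x. a x = 0}"
    by (simp add: op_eigenspace_def)
  have nonempty: "?eigs \<noteq> {}"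
  proof -
    have "(UNIV :: 'v set) \<noteq> {0}"
      using nontrivial by blast
    then obtain v l where "v \<noteq> 0" "a v = scale l v"
      by (rule eigenvector_exists[OF finite_dimensional_vector_space_axioms a.linear_axioms subspace_UNIV]) auto
    then show ?thesis by (auto simp: op_eigenvalues_def)
  qed
  have E1: "?eigs = {0}" if "\<not> op_diagonalizable scale a"
    using nonempty eigenvalue_square not_diagonalizable(1)[OF that] by fastforce
  have E2: "Collect racah_stable = {{0}, ?V 0, UNIV} \<and> {0} \<subset> ?V 0 \<and> ?V 0 \<subset> UNIV"
    if "\<not> op_diagonalizable scale a" "even (dim (UNIV :: 'v set))"
    using nilpotent_even[OF not_diagonalizable(1)[OF that(1)] _ that(2)] not_diagonalizable(2)[OF that(1)]
    unfolding V0 by metis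
  have E3: "(\<exists>!V'. irreducible_on scale ract V' \<and> V' \<subseteq> ?V 0 \<and> dim (?V 0) = dim V' + 1) \<and>
      (\<forall>V'. irreducible_on scale ract V' \<and> V' \<subseteq> ?V 0 \<and> dim (?V 0) = dim V' + 1 \<longrightarrow>
         Collect racah_stable = {{0}, V', ?V 0, UNIV} \<and> {0} \<subset> V' \<and> V' \<subset> ?V 0 \<and> ?V 0 \<subset> UNIV)"
    if nd: "\<not> op_diagonalizable scale a" and odd: "odd (dim (UNIV :: 'v set))"
  proof -
    obtain x0 where x0: "a x0 \<noteq> 0"
      using not_diagonalizable(2)[OF nd] by blast
    note N = nilpotent_odd[OF not_diagonalizable(1)[OF nd] x0 odd, folded V0]
    let ?I = "range a"
    have "irreducible_on scale ract ?I \<and> ?I \<subseteq> ?V 0 \<and> dim (?V 0) = dim ?I + 1"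
      unfolding irreducible_on_def ract N(1) using N by blast
    \<comment> \<open>Irreducibility excludes \<open>{0}\<close>, the codimension excludes
      \<open>?V 0\<close>, and inclusion in \<open>?V 0\<close> excludes the whole space; only the
      image of \<open>a\<close> is left.\<close>
    moreover have "V' = ?I"
      if "irreducible_on scale ract V' \<and> V' \<subseteq> ?V 0 \<and> dim (?V 0) = dim V' + 1" for V'
    proof -
      have "V' \<in> Collect racah_stable" "V' \<noteq> {0}"
        using that unfolding irreducible_on_def ract by blast+
      moreover have "?V 0 \<noteq> V'"
        using that by auto
      moreover have "V' \<noteq> UNIV"
        using that N(4) by blast
      ultimately show ?thesis
        unfolding N(1) by blast
    qed
    ultimately show ?thesis
      using N(1-4) by metis
  qed
  have E4: "finite ?eigs" "card ?eigs \<le> 2"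
  proof -
    obtain \<theta> where "?eigs \<subseteq> {\<theta>, - \<theta>}"
      using nonempty eigenvalues_subset by blast
    moreover have "card {\<theta>, - \<theta>} \<le> 2"
      by (simp add: card_insert_if)
    ultimately show "finite ?eigs" "card ?eigs \<le> 2"
      using finite_subset card_mono[of "{\<theta>, - \<theta>}" ?eigs] by auto
  qed
  have E5: "irreducible_on scale ract UNIV \<and> dim (UNIV :: 'v set) \<le> 2"
    if diag: "op_diagonalizable scale a" and one: "card ?eigs = 1"
  proof -
    obtain \<theta> where "?eigs = {\<theta>}"
      using one card_1_singletonE by blast
    note scalar = scalar_if_one_eigenvalue[OF diag this]
    have "(UNIV :: 'v set) \<noteq> {0}"
      using nontrivial by blast
    then show ?thesis
      unfolding irreducible_on_def ract
      using scalar_racah_stable[OF scalar] racah_stable_UNIV scalar_dim_le[OF scalar] by auto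
  qed
  have E6: "\<exists>\<theta>. \<theta> \<noteq> 0 \<and> ?eigs = {\<theta>, - \<theta>} \<and>
       Collect racah_stable = {{0}, ?V (- \<theta>), ?V \<theta>, UNIV} \<and>
       distinct [{0}, ?V (- \<theta>), ?V \<theta>, UNIV] \<and>
       \<not> ?V (- \<theta>) \<subseteq> ?V \<theta> \<and> \<not> ?V \<theta> \<subseteq> ?V (- \<theta>)"
    if "card ?eigs = 2"
  proof -
    obtain \<theta> where \<theta>: "\<theta> \<in> ?eigs"
      using nonempty by blast
    have sub: "?eigs \<subseteq> {\<theta>, - \<theta>}"
      by (rule eigenvalues_subset[OF \<theta>])
    \<comment> \<open>Two eigenvalues exhaust both square roots of \<open>ka\<close>;
      \<open>\<theta> = 0\<close> would leave only one.\<close>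
    have "card {\<theta>, - \<theta>} \<le> card ?eigs"
      unfolding that by (simp add: card_insert_if)
    with sub have eigs: "?eigs = {\<theta>, - \<theta>}"
      by (intro card_seteq) auto
    have "\<theta> \<noteq> 0"
      using that unfolding eigs by auto
    obtain u where u: "u \<noteq> 0" "a u = scale \<theta> u"
      using \<theta> by (auto simp: op_eigenvalues_def)
    have "- \<theta> \<in> ?eigs" using eigs by simp
    then obtain w where w: "w \<noteq> 0" "a w = scale (- \<theta>) w"
      unfolding op_eigenvalues_def by blast
    show ?thesis
      using two_eigenvalues[OF \<open>\<theta> \<noteq> 0\<close> eigenvalue_square[OF \<theta>, symmetric] u w] \<open>\<theta> \<noteq> 0\<close> eigs
      unfolding op_eigenspace_def by blast
  qed
  show ?thesis
    unfolding Let_def ract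
    by (intro conjI impI)
      (assumption | rule E1 E2[THEN conjunct1] E2[THEN conjunct2, THEN conjunct1]
        E2[THEN conjunct2, THEN conjunct2] E3[THEN conjunct1] E3[THEN conjunct2] E4
        E5[THEN conjunct1] E5[THEN conjunct2] E6)+
qed

end

section \<open>Modules over the additive DAHA\<close>

text \<open>Every algebra element is the image of a combination of words, so stability passes from
  generators to words and then to sums.\<close>

lemma alg_submodulesI:
  fixes scaleA :: "'f::field \<Rightarrow> 'a::ring_1 \<Rightarrow> 'a" and h :: "('f, 'g) free_algebra \<Rightarrow> 'a"
    and scaleV :: "'f \<Rightarrow> 'v::ab_group_add \<Rightarrow> 'v"
  assumes hom: "algebra_hom free_scale scaleA h" and surj: "\<And>x. \<exists>p. h p = x"
    and M: "algebra_module scaleA scaleV act"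
    and W: "module.subspace scaleV W" "\<And>g w. w \<in> W \<Longrightarrow> act (h (free_gen g)) w \<in> W"
  shows "W \<in> alg_submodules scaleV act"
proof -
  interpret h: algebra_hom free_scale scaleA h by fact
  interpret M: algebra_module scaleA scaleV act by fact
  have word: "act (h (Poly_Mapping.single (Word gs) 1)) w \<in> W" if "w \<in> W" for gs w
  proof (induction gs)
    case Nil
    have "Poly_Mapping.single (Word []) 1 = (1 :: ('f, 'g) free_algebra)"
      by (simp flip: zero_word_def)
    then show ?case using that by (simp add: h.hom_one M.act_one)
  next
    case (Cons g gs)
    have "Poly_Mapping.single (Word (g # gs)) 1 =
        free_gen g * (Poly_Mapping.single (Word gs) 1 :: ('f, 'g) free_algebra)"
      by (simp add: free_gen_def mult_single plus_word_def)
    then show ?case using Cons W(2) by (simp add: h.hom_mult M.act_mult)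
  qed
  have single: "act (h (Poly_Mapping.single u r)) w \<in> W" if "w \<in> W" for u r w
  proof -
    have "Poly_Mapping.single u r = free_scale r (Poly_Mapping.single u 1)"
      by (simp add: free_scale_def mult_single)
    then show ?thesis
      using M.vs.subspace_scale[OF W(1) word[OF that, of "letters u"]]
      by (simp only: h.hom_scale M.act_scale word.collapse)
  qed
  have zero: "act 0 w = 0" for w
    using M.act_add_left[of 0 0 w] by simp
  have mem: "act (h p) w \<in> W" if "w \<in> W" for p w
    by (induction p rule: poly_mapping_induct_single)
      (simp_all add: h.hom_zero zero h.hom_add M.act_add_left M.vs.subspace_0 M.vs.subspace_add W(1) single that)
  have "act x w \<in> W" if "w \<in> W" for x w
  proof -
    obtain p where "h p = x" using surj by blast
    then show ?thesis using mem[OF that, of p] by simp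
  qed
  then show ?thesis
    using W(1) by (simp add: alg_submodules_def)
qed

lemma daha_submoduleI:
  assumes M: "algebra_module daha_scale scaleV act" and W: "module.subspace scaleV W"
    "\<And>w. w \<in> W \<Longrightarrow> act daha_t0 w \<in> W" "\<And>w. w \<in> W \<Longrightarrow> act daha_t1 w \<in> W"
    "\<And>w. w \<in> W \<Longrightarrow> act daha_t0v w \<in> W" "\<And>w. w \<in> W \<Longrightarrow> act daha_t1v w \<in> W"
  shows "W \<in> alg_submodules scaleV act"
proof (rule alg_submodulesI[OF abs_daha_hom _ M W(1)])
  show "\<exists>p. abs_daha p = x" for x :: "'a daha"
    using Quotient3_abs_rep[OF Quotient3_daha] by blast
  show "act (abs_daha (free_gen g)) w \<in> W" if "w \<in> W" for g w
    using W(2-5)[OF that] by (cases g) (simp_all add: daha_t0_def daha_t1_def daha_t0v_def daha_t1v_def)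
qed

text \<open>\<open>D\<close> is half the commutator of \<open>A\<close> and \<open>B\<close>, which
  supplies stability under it.\<close>

lemma racah_submoduleI:
  assumes M: "algebra_module racah_scale scaleV act" and W: "module.subspace scaleV W"
    "\<And>w. w \<in> W \<Longrightarrow> act racah_A w \<in> W" "\<And>w. w \<in> W \<Longrightarrow> act racah_B w \<in> W"
    "\<And>w. w \<in> W \<Longrightarrow> act racah_C w \<in> W"
  shows "W \<in> alg_submodules scaleV act"
proof (rule alg_submodulesI[OF abs_racah_hom _ M W(1)])
  interpret M: algebra_module racah_scale scaleV act by fact
  show "\<exists>p. abs_racah p = x" for x :: "'a racah"
    using Quotient3_abs_rep[OF Quotient3_racah] by blast
  have D: "act racah_D w \<in> W" if "w \<in> W" for w
  proof -
    have "act racah_D w = act (racah_scale (1/2) (racah_A * racah_B - racah_B * racah_A)) w"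
      unfolding racah_commutator by simp
    also have "\<dots> = scaleV (1/2) (act racah_A (act racah_B w) - act racah_B (act racah_A w))"
    proof -
      have "act (x - y) w + act y w = act x w" for x y
        using M.act_add_left[of "x - y" y w] by simp
      then have "act (x - y) w = act x w - act y w" for x y
        by (simp add: eq_diff_eq)
      then show ?thesis by (simp add: M.act_scale M.act_mult)
    qed
    finally show ?thesis
      using W that by (simp add: M.vs.subspace_scale M.vs.subspace_diff)
  qed
  show "act (abs_racah (free_gen g)) w \<in> W" if "w \<in> W" for g w
    using W(2-4)[OF that] D[OF that]
    by (cases g) (simp_all add: racah_A_def racah_B_def racah_C_def racah_D_def)
qed

text \<open>Homogeneity in the vector comes from letting scalars act as the central elements
  \<open>scaleA r 1\<close>.\<close>

lemma (in algebra_module) linear_act: "Vector_Spaces.linear scaleV scaleV (act x)"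
proof -
  have "act x (scaleV r v) = scaleV r (act x v)" for r v
  proof -
    have "act x (act (scaleA r 1) v) = act (scaleA r x) v"
      by (simp add: alg.scale_mult_right flip: act_mult)
    then show ?thesis by (simp add: act_scale act_one)
  qed
  then show ?thesis
    by unfold_locales (simp_all add: act_add_right)
qed

theorem theorem5p1:
  fixes scaleV :: "'f::{alg_closed_field, field_char_0} \<Rightarrow> 'v::ab_group_add \<Rightarrow> 'v"
    and act :: "'f daha \<Rightarrow> 'v \<Rightarrow> 'v"
  assumes "algebra_module daha_scale scaleV act"
    and "\<exists>Basis. finite_dimensional_vector_space scaleV Basis"
    and "irreducible_on scaleV act UNIV"
  shows
    "(let t0 = act daha_t0;
          V = op_eigenspace scaleV t0;
          eigs = op_eigenvalues scaleV t0;
          dimV = vector_space.dim scaleV;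
          ract = racah_pullback act;
          subs = alg_submodules scaleV ract
      in
        (\<not> op_diagonalizable scaleV t0 \<longrightarrow>
           eigs = {0} \<and>
           (even (dimV UNIV) \<longrightarrow>
              subs = {{0}, V 0, UNIV} \<and> {0} \<subset> V 0 \<and> V 0 \<subset> UNIV) \<and>
           (odd (dimV UNIV) \<longrightarrow>
              (\<exists>!V'. irreducible_on scaleV ract V' \<and> V' \<subseteq> V 0 \<and> dimV (V 0) = dimV V' + 1) \<and>
              (\<forall>V'. irreducible_on scaleV ract V' \<and> V' \<subseteq> V 0 \<and> dimV (V 0) = dimV V' + 1 \<longrightarrow>
                 subs = {{0}, V', V 0, UNIV} \<and>
                 {0} \<subset> V' \<and> V' \<subset> V 0 \<and> V 0 \<subset> UNIV)))
        \<and>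
        (op_diagonalizable scaleV t0 \<longrightarrow>
           finite eigs \<and> card eigs \<le> 2 \<and>
           (card eigs = 1 \<longrightarrow>
              irreducible_on scaleV ract UNIV \<and> dimV UNIV \<le> 2) \<and>
           (card eigs = 2 \<longrightarrow>
              (\<exists>\<theta>. \<theta> \<noteq> 0 \<and> eigs = {\<theta>, - \<theta>} \<and>
                 subs = {{0}, V (- \<theta>), V \<theta>, UNIV} \<and>
                 distinct [{0}, V (- \<theta>), V \<theta>, UNIV] \<and>
                 \<not> V (- \<theta>) \<subseteq> V \<theta> \<and> \<not> V \<theta> \<subseteq> V (- \<theta>)))))"
proof -
  obtain Basis where V: "finite_dimensional_vector_space scaleV Basis"
    using assms(2) by blast
  interpret finite_dimensional_vector_space scaleV Basis by (rule V)
  interpret M: algebra_module daha_scale scaleV act by (rule assms(1))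
  let ?gens = "{daha_t0, daha_t1, daha_t0v, daha_t1v} :: 'f daha set"
  have sum0: "act daha_t0 x + act daha_t1 x + act daha_t0v x + act daha_t1v x + x = 0" for x
  proof -
    have "act 0 x = 0"
      using M.act_add_left[of 0 0 x] by simp
    then show ?thesis
      using arg_cong[OF daha_sum, of "\<lambda>y. act y x"] by (simp only: M.act_add_left M.act_one)
  qed
  have d_eq: "act daha_t1v x = - (x + act daha_t0 x + act daha_t1 x + act daha_t0v x)" for x
    using sum0[of x] by (simp add: eq_neg_iff_add_eq_0 algebra_simps)
  have nontrivial: "\<exists>x::'v. x \<noteq> 0"
    using assms(3) by (auto simp: irreducible_on_def)
  have irred: "W = UNIV" if "subspace W" "\<And>S x. \<lbrakk>S \<in> act ` ?gens; x \<in> W\<rbrakk> \<Longrightarrow> S x \<in> W" "W \<noteq> {0}" for W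
  proof -
    have "W \<in> alg_submodules scaleV act"
      by (rule daha_submoduleI[OF assms(1) that(1)]) (simp_all add: that(2))
    then show ?thesis
      using assms(3) that(3) unfolding irreducible_on_def by blast
  qed
  \<comment> \<open>The square of a generator is central, so Schur's lemma makes it a
    scalar.\<close>
  have central: "\<exists>k. \<forall>x. act g (act g x) = scaleV k x" if g: "g \<in> ?gens" for g
  proof -
    have comm: "act (g * g) (S x) = S (act (g * g) x)" if S: "S \<in> act ` ?gens" for S x
    proof -
      obtain y where y: "S = act y" "y \<in> ?gens" using S by blast
      then show ?thesis
        using daha_square_central g by (metis M.act_mult)
    qed
    have lin: "S (scaleV r x) = scaleV r (S x)" if "S \<in> act ` ?gens" for S r x
      using that M.linear_act by (auto simp: Vector_Spaces.linear_iff)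
    obtain k where "\<And>x. act (g * g) x = scaleV k x"
      using commuting_operator_scalar[where Ts = "act ` ?gens", OF V nontrivial irred M.linear_act comm lin]
      by blast
    then show ?thesis by (auto simp: M.act_mult)
  qed
  obtain ka kb kc kd where k: "\<And>x. act daha_t0 (act daha_t0 x) = scaleV ka x"
    "\<And>x. act daha_t1 (act daha_t1 x) = scaleV kb x"
    "\<And>x. act daha_t0v (act daha_t0v x) = scaleV kc x"
    "\<And>x. act daha_t1v (act daha_t1v x) = scaleV kd x"
    using central[of daha_t0] central[of daha_t1] central[of daha_t0v] central[of daha_t1v] by auto
  interpret D: daha_operators scaleV Basis "act daha_t0" "act daha_t1" "act daha_t0v" ka kb kc kd "act daha_t1v"
  proof (intro daha_operators.intro V M.linear_act daha_operators_axioms.intro k d_eq nontrivial)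
    fix W
    assume W: "subspace W" "\<And>x. x \<in> W \<Longrightarrow> act daha_t0 x \<in> W" "\<And>x. x \<in> W \<Longrightarrow> act daha_t1 x \<in> W"
      "\<And>x. x \<in> W \<Longrightarrow> act daha_t0v x \<in> W" "W \<noteq> {0}"
    have "act daha_t1v x \<in> W" if "x \<in> W" for x
      unfolding d_eq using W that by (intro subspace_neg subspace_add) auto
    then show "W = UNIV"
      using W by (intro irred) auto
  qed
  have two: "act 2 x = x + x" for x
    by (metis M.act_add_left M.act_one one_add_one)
  have ABC: "racah_pullback act racah_A x = scaleV (1/4) (D.ab x + scaleV (ka + kb - 1) x)"
    "racah_pullback act racah_B x = scaleV (1/4) (D.ac x + scaleV (ka + kc - 1) x)"
    "racah_pullback act racah_C x = scaleV (1/4) (scaleV (kd - 1 - ka) x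
       - act daha_t0 x - act daha_t0 x - D.ab x - D.ac x)" for x
    using zeta_props[where 'f='f]
    by (simp_all add: racah_pullback_def M.act_scale M.act_mult M.act_add_left two
        D.racah_quadratic_AB D.racah_quadratic_C)
  \<comment> \<open>By \<open>ABC\<close>, \<open>A\<close> yields \<open>D.ab\<close>,
    \<open>B\<close> yields \<open>D.ac\<close>, and then \<open>C\<close> yields twice
    \<open>act daha_t0\<close>. Conversely \<open>A\<close>, \<open>B\<close>, \<open>C\<close> act
    by combinations of these operators.\<close>
  have "alg_submodules scaleV (racah_pullback act) = Collect D.racah_stable"
  proof (intro equalityI subsetI CollectI)
    fix W assume "W \<in> alg_submodules scaleV (racah_pullback act)"
    then have W: "subspace W" "\<And>r x. x \<in> W \<Longrightarrow> racah_pullback act r x \<in> W"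
      by (auto simp: alg_submodules_def)
    note closed = subspace_add[OF W(1)] subspace_diff[OF W(1)] subspace_scale[OF W(1)]
    have quarter: "x \<in> W" if "scaleV (1/4) x \<in> W" for x
      using closed(3)[OF that, of 4] by simp
    have ab: "D.ab x \<in> W" if "x \<in> W" for x
      using closed(2)[OF quarter[OF W(2)[OF that, of racah_A, unfolded ABC]] closed(3)[OF that, of "ka + kb - 1"]]
      by simp
    have ac: "D.ac x \<in> W" if "x \<in> W" for x
      using closed(2)[OF quarter[OF W(2)[OF that, of racah_B, unfolded ABC]] closed(3)[OF that, of "ka + kc - 1"]]
      by simp
    have "act daha_t0 x \<in> W" if x: "x \<in> W" for x
    proof -
      let ?y = "scaleV (kd - 1 - ka) x - act daha_t0 x - act daha_t0 x - D.ab x - D.ac x"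
      have y: "?y \<in> W"
        by (rule quarter[OF W(2)[OF x, of racah_C, unfolded ABC]])
      have "scaleV (kd - 1 - ka) x - D.ab x - D.ac x - ?y \<in> W"
        by (rule closed(2)[OF closed(2)[OF closed(2)[OF closed(3)[OF x] ab[OF x]] ac[OF x]] y])
      then have "act daha_t0 x + act daha_t0 x \<in> W"
        by (simp add: algebra_simps)
      then show ?thesis
        by (rule D.halve[OF W(1)])
    qed
    then show "D.racah_stable W"
      using W(1) ab ac by (simp add: D.racah_stable_def)
  next
    fix W assume "W \<in> Collect D.racah_stable"
    then have "D.racah_stable W" by simp
    note W = D.racah_stableD[OF this]
    show "W \<in> alg_submodules scaleV (racah_pullback act)"
      by (rule racah_submoduleI[OF racah_pullback_module[OF assms(1)] W(1)])
        (simp_all add: ABC W subspace_add[OF W(1)] subspace_diff[OF W(1)] subspace_scale[OF W(1)])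
  qed
  from D.submodule_lattice[OF this] show ?thesis
    unfolding Let_def .
qed

end
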